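(* (a) Let $X$ be a complex Banach space and let $E,F\in L(X)$ be two invertible and positive operators. Then, for $T\in L(X)$, the following statements are equivalent: (i) $T$ is weighted EP with weights $E$ and $F$; (ii) there exists an idempotent $P\in L(X)$ such that $P\in H(L(X)^E)\cap H(L(X)^F)$, $R(P)=R(T)$ and $N(P)=N(T)$. (b) Let $A$ be a complex unital Banach algebra and let $e,f\in A$ be two invertible and positive elements. Then, if $a\in A$ is such that $a^{\dag}_{e,f}$ exists, the following statements are equivalent: (iii) $a$ is weighted EP with weights $e$ and $f$; (iv) there exists an idempotent $P\in L(A)$ such that $P\in H(L(A)^{L_e})\cap H(L(A)^{L_f})$, $R(P)=aA$ and $N(P)=a^{-1}(0)$; (v) $L_a\in L(A)$ is weighted EP with weights $L_e$ and $L_f$. Furthermore, if in (a) or (b) such a $P$ exists, then it is unique.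
   Context: Let $A$ be a complex unital Banach algebra. An element $h\in A$ is hermitian if $\|\exp(ith)\|=1$ for all $t\in\mathbb R$ (for $t=0$ this entails $\|1\|=1$); $H(A)$ is the set of hermitian elements of $A$. An element $c\in A$ is positive if $V(c)=\{\varphi(c):\varphi\in A^*,\ \|\varphi\|\le 1,\ \varphi(1)=1\}\subset[0,\infty)$; equivalently, $c$ is hermitian and $\sigma(c)\subset[0,\infty)$. A positive element $c$ has a unique positive square root, denoted $c^{1/2}$. For $u\in A$ invertible and positive, $u^{-1/2}=(u^{1/2})^{-1}$, and $A^u$ denotes the complex unital Banach algebra $A$ endowed with the norm $\|x\|_u=\|u^{1/2}xu^{-1/2}\|$; thus $h\in H(A^u)$ means $\|\exp(ith)\|_u=1$ for all $t\in\mathbb R$. An element $b\in A$ is a normalized generalized inverse of $a\in A$ if $aba=a$ and $bab=b$. Given $e,f\in A$ invertible and positive, $a$ is weighted Moore-Penrose invertible with weights $e$ and $f$ if there is a normalized generalized inverse $b$ of $a$ with $ab\in H(A^e)$ and $ba\in H(A^f)$; such $b$ is unique when it exists and is denoted $a^{\dag}_{e,f}$. The element $a$ is weighted EP with weights $e$ and $f$ if $a^{\dag}_{e,f}$ exists and commutes with $a$. For a Banach space $X$, $L(X)$ is the Banach algebra of bounded linear operators on $X$ with the operator norm; the notions of hermitian element, positive element, positive square root, renormed algebra $A^u$, normalized generalized inverse, weighted Moore-Penrose inverse and weighted EP element are applied with $A=L(X)$. Explicitly, for $E,F\in L(X)$ invertible and positive, $L(X)^E$ is $L(X)$ with the norm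 $\|S\|_E=\|E^{1/2}SE^{-1/2}\|$, and $T\in L(X)$ is weighted EP with weights $E$ and $F$ if there is $S\in L(X)$ with $TST=T$, $STS=S$, $TS\in H(L(X)^E)$, $ST\in H(L(X)^F)$ and $TS=ST$. $R(T)$ and $N(T)$ are the range and null space of $T$. For $a\in A$, $L_a\in L(A)$ is $L_a(x)=ax$, $aA=R(L_a)$ and $a^{-1}(0)=N(L_a)=\{x\in A: ax=0\}$. If $e\in A$ is invertible and positive, then $L_e$ is invertible and positive in $L(A)$.
   Formalization: A positive invertible element of a Banach algebra need not have a positive square root, so A^u may be undefined; here membership in H(A^u) includes the requirement that u has a unique positive square root, which changes nothing whenever u^{1/2} exists. *)

theory Defs
  imports "HOL-Analysis.Analysis"
begin

section \<open>Complex Banach spaces and complex unital Banach algebras\<close>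

text \<open>The distribution only has real normed spaces and algebras, so a compatible complex scalar
  multiplication is added on top of the real classes.\<close>

class scaleC =
  fixes scaleC :: "complex \<Rightarrow> 'a \<Rightarrow> 'a"  (infixr \<open>*\<^sub>C\<close> 75)

class complex_banach = banach + scaleC +
  assumes scaleC_add_right: "z *\<^sub>C (x + y) = z *\<^sub>C x + z *\<^sub>C y"
    and scaleC_add_left: "(z + w) *\<^sub>C x = z *\<^sub>C x + w *\<^sub>C x"
    and scaleC_scaleC: "z *\<^sub>C w *\<^sub>C x = (z * w) *\<^sub>C x"
    and scaleC_of_real: "complex_of_real r *\<^sub>C x = r *\<^sub>R x"
    and norm_scaleC: "norm (z *\<^sub>C x) = cmod z * norm x"

text \<open>The classes \<open>ring_1\<close> and \<open>real_normed_algebra_1\<close> are avoided on purpose: neither \<open>1 \<noteq> 0\<close> nor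
  \<open>norm 1 = 1\<close> is imposed, so that the operators on the zero space form an instance as well.\<close>

class complex_unital_banach_algebra = complex_banach + real_normed_algebra + monoid_mult +
  assumes mult_scaleC_left: "(z *\<^sub>C x) * y = z *\<^sub>C (x * y)"
    and mult_scaleC_right: "x * (z *\<^sub>C y) = z *\<^sub>C (x * y)"

section \<open>The Banach algebra of bounded complex-linear operators\<close>

typedef (overloaded) 'a cblinop =
  "{T :: 'a::complex_banach \<Rightarrow>\<^sub>L 'a. \<forall>z x. blinfun_apply T (z *\<^sub>C x) = z *\<^sub>C blinfun_apply T x}"
  morphisms blinfun_of Cblinop
  by (rule exI[of _ id_blinfun]) simp

setup_lifting type_definition_cblinop

lemma bounded_linear_scaleC: "bounded_linear (\<lambda>x::'a::complex_banach. z *\<^sub>C x)"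
proof (rule bounded_linear_intro[where K = "cmod z"])
  show "z *\<^sub>C (r *\<^sub>R x) = r *\<^sub>R z *\<^sub>C x" for r and x :: 'a
    by (simp add: scaleC_of_real[symmetric] scaleC_scaleC mult.commute)
qed (simp_all add: scaleC_add_right norm_scaleC mult.commute)

lift_definition app :: "'a::complex_banach cblinop \<Rightarrow> 'a \<Rightarrow> 'a" is blinfun_apply .

lemma cblinop_eqI: "(\<And>x. app S x = app T x) \<Longrightarrow> S = T"
  by transfer (rule blinfun_eqI)

lemma app_scaleC: "app T (z *\<^sub>C x) = z *\<^sub>C app T x"
  by transfer simp

instantiation cblinop :: (complex_banach) real_normed_vector
begin

lift_definition zero_cblinop :: "'a cblinop" is 0
  using norm_scaleC[of _ 0] by simp

lift_definition plus_cblinop :: "'a cblinop \<Rightarrow> 'a cblinop \<Rightarrow> 'a cblinop" is "(+)"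
  by (simp add: blinfun.add_left scaleC_add_right)

lift_definition uminus_cblinop :: "'a cblinop \<Rightarrow> 'a cblinop" is uminus
  by (simp add: blinfun.minus_left linear_neg[OF bounded_linear.linear[OF bounded_linear_scaleC]])

lift_definition minus_cblinop :: "'a cblinop \<Rightarrow> 'a cblinop \<Rightarrow> 'a cblinop" is "(-)"
  by (simp add: blinfun.diff_left linear_diff[OF bounded_linear.linear[OF bounded_linear_scaleC]])

lift_definition scaleR_cblinop :: "real \<Rightarrow> 'a cblinop \<Rightarrow> 'a cblinop" is "(*\<^sub>R)"
  by (simp add: blinfun.scaleR_left scaleC_of_real[symmetric] scaleC_scaleC mult.commute)

lift_definition norm_cblinop :: "'a cblinop \<Rightarrow> real" is norm .

definition dist_cblinop :: "'a cblinop \<Rightarrow> 'a cblinop \<Rightarrow> real"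
  where "dist_cblinop S T = norm (S - T)"

definition sgn_cblinop :: "'a cblinop \<Rightarrow> 'a cblinop"
  where "sgn_cblinop T = scaleR (inverse (norm T)) T"

definition uniformity_cblinop :: "('a cblinop \<times> 'a cblinop) filter"
  where [code del]: "uniformity_cblinop = (INF e\<in>{0 <..}. principal {(S, T). dist S T < e})"

definition open_cblinop :: "'a cblinop set \<Rightarrow> bool"
  where [code del]: "open_cblinop U = (\<forall>S\<in>U. \<forall>\<^sub>F (S', T) in uniformity. S' = S \<longrightarrow> T \<in> U)"

instance
  apply standard
  unfolding dist_cblinop_def open_cblinop_def sgn_cblinop_def uniformity_cblinop_def
  by (rule refl | (transfer, simp add: algebra_simps norm_triangle_ineq))+

end

lemma norm_app_le: "norm (app T x) \<le> norm T * norm x"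
  by transfer (rule norm_blinfun)

lemma norm_cblinop_bound: "0 \<le> b \<Longrightarrow> (\<And>x. norm (app T x) \<le> b * norm x) \<Longrightarrow> norm T \<le> b"
  by transfer (rule norm_blinfun_bound)

instance cblinop :: (complex_banach) banach
proof
  fix X :: "nat \<Rightarrow> 'a cblinop"
  assume "Cauchy X"
  have dist_eq: "dist S T = dist (blinfun_of S) (blinfun_of T)" for S T :: "'a cblinop"
    by (simp add: dist_norm norm_cblinop.rep_eq minus_cblinop.rep_eq)
  have "Cauchy (\<lambda>n. blinfun_of (X n))"
    using \<open>Cauchy X\<close> by (simp add: Cauchy_def dist_eq)
  then obtain T where T: "(\<lambda>n. blinfun_of (X n)) \<longlonglongrightarrow> T"
    using Cauchy_convergent_iff convergent_def by blast
  have lim: "(\<lambda>n. blinfun_apply (blinfun_of (X n)) x) \<longlonglongrightarrow> blinfun_apply T x" for x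
    by (intro tendsto_intros T)
  have "blinfun_apply T (z *\<^sub>C x) = z *\<^sub>C blinfun_apply T x" for z x
  proof (rule LIMSEQ_unique[OF lim])
    show "(\<lambda>n. blinfun_apply (blinfun_of (X n)) (z *\<^sub>C x)) \<longlonglongrightarrow> z *\<^sub>C blinfun_apply T x"
      using bounded_linear.tendsto[OF bounded_linear_scaleC lim, of z x]
      by (simp add: app_scaleC[unfolded app.rep_eq])
  qed
  then have "blinfun_of (Cblinop T) = T"
    by (simp add: Cblinop_inverse)
  then have "X \<longlonglongrightarrow> Cblinop T"
    using T by (simp add: lim_sequentially dist_eq)
  then show "convergent X"
    by (auto simp: convergent_def)
qed

instantiation cblinop :: (complex_banach) complex_banach
begin

lift_definition scaleC_cblinop :: "complex \<Rightarrow> 'a cblinop \<Rightarrow> 'a cblinop"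
  is "\<lambda>z T. Blinfun (\<lambda>x. z *\<^sub>C blinfun_apply T x)"
  by (simp add: bounded_linear_Blinfun_apply bounded_linear_compose[OF bounded_linear_scaleC]
      blinfun.bounded_linear_right scaleC_scaleC mult.commute)

lemma app_scaleC_left: "app (z *\<^sub>C T) x = z *\<^sub>C app T x"
  by transfer (simp add: bounded_linear_Blinfun_apply
      bounded_linear_compose[OF bounded_linear_scaleC] blinfun.bounded_linear_right)

lemma app_add_left: "app (S + T) x = app S x + app T x"
  by transfer (simp add: blinfun.add_left)

lemma app_scaleR_left: "app (r *\<^sub>R T) x = r *\<^sub>R app T x"
  by transfer (simp add: blinfun.scaleR_left)

instance
proof
  fix S T :: "'a cblinop" and r :: real and z w :: complex
  show "z *\<^sub>C (S + T) = z *\<^sub>C S + z *\<^sub>C T" "(z + w) *\<^sub>C T = z *\<^sub>C T + w *\<^sub>C T"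
    and scaleC_scaleC': "\<And>z w T. z *\<^sub>C w *\<^sub>C T = (z * w) *\<^sub>C (T :: 'a cblinop)"
    and scaleC_of_real': "\<And>r T. complex_of_real r *\<^sub>C T = r *\<^sub>R (T :: 'a cblinop)"
    by (rule cblinop_eqI; simp add: app_scaleC_left app_add_left app_scaleR_left scaleC_add_left
        scaleC_add_right scaleC_scaleC scaleC_of_real)+
  have le: "norm (w *\<^sub>C T) \<le> cmod w * norm T" for w and T :: "'a cblinop"
  proof (rule norm_cblinop_bound)
    show "norm (app (w *\<^sub>C T) x) \<le> cmod w * norm T * norm x" for x
      using mult_left_mono[OF norm_app_le[of T x], of "cmod w"]
      by (simp add: app_scaleC_left norm_scaleC mult.assoc)
  qed simp
  show "norm (z *\<^sub>C T) = cmod z * norm T"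
  proof (cases "z = 0")
    case True
    then show ?thesis
      using scaleC_of_real'[of 0 T] by simp
  next
    case False
    then have "inverse z *\<^sub>C z *\<^sub>C T = T"
      using scaleC_of_real'[of 1 T] by (simp add: scaleC_scaleC')
    then have "norm T \<le> cmod (inverse z) * norm (z *\<^sub>C T)"
      using le[of "inverse z" "z *\<^sub>C T"] by simp
    then have "cmod z * norm T \<le> norm (z *\<^sub>C T)"
      using False by (simp add: norm_divide field_simps)
    with le[of z T] show ?thesis
      by simp
  qed
qed

end

instantiation cblinop :: (complex_banach) complex_unital_banach_algebra
begin

lift_definition one_cblinop :: "'a cblinop" is id_blinfun
  by simp

lift_definition times_cblinop :: "'a cblinop \<Rightarrow> 'a cblinop \<Rightarrow> 'a cblinop" is "(o\<^sub>L)"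
  by simp

lemma app_one: "app 1 x = x"
  by transfer simp

lemma app_mult: "app (S * T) x = app S (app T x)"
  by transfer simp

lemma app_add_right: "app T (x + y) = app T x + app T y"
  by transfer (simp add: blinfun.add_right)

lemma app_scaleR_right: "app T (r *\<^sub>R x) = r *\<^sub>R app T x"
  by transfer (simp add: blinfun.scaleR_right)

instance
proof
  show "norm (S * T) \<le> norm S * norm T" for S T :: "'a cblinop"
    by transfer (rule norm_blinfun_compose)
qed (rule cblinop_eqI; simp add: app_one app_mult app_add_left app_add_right app_scaleR_left
    app_scaleR_right app_scaleC_left app_scaleC)+

end

lift_definition left_mult :: "'a::complex_unital_banach_algebra \<Rightarrow> 'a cblinop" is blinfun_mult_right
  by (simp add: mult_scaleC_right)

lemma app_left_mult [simp]: "app (left_mult a) x = a * x"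
  by transfer simp

abbreviation op_range :: "'a::complex_banach cblinop \<Rightarrow> 'a set"
  where "op_range T \<equiv> range (app T)"

definition null_space :: "'a::complex_banach cblinop \<Rightarrow> 'a set"
  where "null_space T = {x. app T x = 0}"

section \<open>Hermitian and positive elements\<close>

text \<open>The library function \<open>exp\<close> needs \<open>norm 1 = 1\<close>; this is its defining series.\<close>

definition alg_exp :: "'a::complex_unital_banach_algebra \<Rightarrow> 'a"
  where "alg_exp x = (\<Sum>n. x ^ n /\<^sub>R fact n)"

text \<open>The parameter \<open>N\<close> stands for an equivalent algebra norm; the exponential series has the same sum for
  every equivalent norm, so it may be evaluated in the original one.\<close>

definition hermitian_wrt :: "('a::complex_unital_banach_algebra \<Rightarrow> real) \<Rightarrow> 'a \<Rightarrow> bool"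
  where "hermitian_wrt N h \<longleftrightarrow> (\<forall>t::real. N (alg_exp ((\<i> * complex_of_real t) *\<^sub>C h)) = 1)"

definition numerical_range :: "'a::complex_unital_banach_algebra \<Rightarrow> complex set"
  where "numerical_range c = {blinfun_apply \<phi> c | \<phi>.
    (\<forall>z x. blinfun_apply \<phi> (z *\<^sub>C x) = z * blinfun_apply \<phi> x) \<and> norm \<phi> \<le> 1 \<and> blinfun_apply \<phi> 1 = 1}"

definition is_positive :: "'a::complex_unital_banach_algebra \<Rightarrow> bool"
  where "is_positive c \<longleftrightarrow> numerical_range c \<subseteq> \<real>\<^sub>\<ge>\<^sub>0"

definition is_invertible :: "'a::monoid_mult \<Rightarrow> bool"
  where "is_invertible u \<longleftrightarrow> (\<exists>v. u * v = 1 \<and> v * u = 1)"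

definition inverse_of :: "'a::monoid_mult \<Rightarrow> 'a"
  where "inverse_of u = (THE v. u * v = 1 \<and> v * u = 1)"

definition is_positive_sqrt :: "'a::complex_unital_banach_algebra \<Rightarrow> 'a \<Rightarrow> bool"
  where "is_positive_sqrt c d \<longleftrightarrow> is_positive d \<and> d * d = c"

definition positive_sqrt :: "'a::complex_unital_banach_algebra \<Rightarrow> 'a"
  where "positive_sqrt c = (THE d. is_positive_sqrt c d)"

section \<open>The renormed algebra and weighted Moore-Penrose inverses\<close>

definition weighted_norm :: "'a::complex_unital_banach_algebra \<Rightarrow> 'a \<Rightarrow> real"
  where "weighted_norm u x = norm (positive_sqrt u * x * inverse_of (positive_sqrt u))"

text \<open>\<open>weighted_hermitian u\<close> is the set of hermitian elements of the algebra with norm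
  \<open>weighted_norm u\<close>.  The first conjunct says that the positive square root occurring in that norm
  is well defined, so that the definite description in \<open>positive_sqrt\<close> never denotes an arbitrary
  element.  Positivity and invertibility of \<open>u\<close> alone do not ensure this: outside C*-algebras the
  principal square root of such an element may fail to be hermitian.\<close>

definition weighted_hermitian :: "'a::complex_unital_banach_algebra \<Rightarrow> 'a set"
  where "weighted_hermitian u =
    {h. (\<exists>!d. is_positive_sqrt u d) \<and> hermitian_wrt (weighted_norm u) h}"

definition normalized_generalized_inverse :: "'a::monoid_mult \<Rightarrow> 'a \<Rightarrow> bool"
  where "normalized_generalized_inverse a b \<longleftrightarrow> a * b * a = a \<and> b * a * b = b"

definition is_weighted_MP_inverse :: "'a::complex_unital_banach_algebra \<Rightarrow> 'a \<Rightarrow> 'a \<Rightarrow> 'a \<Rightarrow> bool"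
  where "is_weighted_MP_inverse e f a b \<longleftrightarrow> normalized_generalized_inverse a b \<and>
    a * b \<in> weighted_hermitian e \<and> b * a \<in> weighted_hermitian f"

definition weighted_MP_invertible :: "'a::complex_unital_banach_algebra \<Rightarrow> 'a \<Rightarrow> 'a \<Rightarrow> bool"
  where "weighted_MP_invertible e f a \<longleftrightarrow> (\<exists>b. is_weighted_MP_inverse e f a b)"

text \<open>Weighted Moore-Penrose inverses are unique, so this says that the weighted Moore-Penrose inverse
  of \<open>a\<close> exists and commutes with \<open>a\<close>.\<close>

definition weighted_EP :: "'a::complex_unital_banach_algebra \<Rightarrow> 'a \<Rightarrow> 'a \<Rightarrow> bool"
  where "weighted_EP e f a \<longleftrightarrow> (\<exists>b. is_weighted_MP_inverse e f a b \<and> a * b = b * a)"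

end

theory Submission
  imports Defs "HOL-Complex_Analysis.Cauchy_Integral_Formula"
begin

text \<open>For operators, \<open>P\<close> and the weighted Moore--Penrose inverse \<open>S\<close> determine each other by
  \<open>P = T * S = S * T\<close>, and the hermitian conditions on both sides are literally the same.  Thus the
  equivalence is a purely linear one (\<open>commuting_generalized_inverse_iff\<close>): an idempotent with the
  range and null space of \<open>T\<close> yields a commuting normalized generalized inverse, whose boundedness is
  the bounded inverse theorem.  An idempotent is determined by its range and null space, whence the
  uniqueness of \<open>P\<close>.

  For an element \<open>a\<close> of an algebra, the operator statement applied to \<open>left_mult a\<close> connects the
  idempotent with the weighted EP property of \<open>left_mult a\<close>.  It remains to pass between \<open>a\<close> and
  \<open>left_mult a\<close>.

  From \<open>a\<close> to \<open>left_mult a\<close>, the difficulty is that the weighted norm for \<open>left_mult e\<close> involves the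
  positive square root of \<open>left_mult e\<close> in the algebra of all operators.  That it is
  \<open>left_mult\<close> of the positive square root of \<open>e\<close> follows from \<open>positive_sqrt_unique\<close>.  Two positive
  roots \<open>d\<close>, \<open>d'\<close> of an invertible element satisfy \<open>d * (d - d') = (d - d') * (- d')\<close>, and the spectra
  of \<open>d\<close> and \<open>- d'\<close> are disjoint, so that \<open>d - d' = 0\<close> by Rosenblum's theorem (\<open>intertwiner_zero\<close>),
  a consequence of Liouville's theorem.  Positivity is a condition on functionals; norming functionals,
  obtained by a Hahn--Banach argument, turn it into the location of the spectrum
  (\<open>resolvent_set_positive\<close>).

  From \<open>left_mult a\<close> back to \<open>a\<close>, the existing weighted Moore--Penrose inverse \<open>b\<close> of \<open>a\<close> gives the
  hermitian idempotents \<open>a * b\<close> and \<open>b * a\<close>.  As operators, the first shares its range with \<open>P\<close> and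
  the second its null space; hermitian idempotents that share either are equal
  (\<open>hermitian_idempotents_eq\<close>), and so \<open>a * b = b * a\<close>.\<close>

section \<open>The bounded inverse theorem\<close>

text \<open>By the Baire category theorem the closure of the image of some ball has interior points, and by
  linearity that interior may be moved to the origin and rescaled: every \<open>y\<close> is approximated, up to
  half its norm, by the image of a point of comparable norm.\<close>

lemma approximate_preimages:
  fixes f :: "'a::real_normed_vector \<Rightarrow> 'b::banach"
  assumes f: "bounded_linear f" and surj: "surj f"
  obtains C where "0 \<le> C" "\<And>y. \<exists>x. norm x \<le> C * norm y \<and> norm (y - f x) \<le> norm y / 2"
proof -
  interpret f: bounded_linear f by (rule f)
  define S where "S = (\<lambda>n::nat. closure (f ` cball 0 (real n)))"
  have cover: "\<Union>(range S) = UNIV"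
  proof -
    have "f x \<in> \<Union>(range S)" for x
    proof -
      obtain n :: nat where "norm x \<le> real n"
        using real_arch_simple by blast
      then have "f x \<in> f ` cball 0 (real n)"
        by simp
      then show ?thesis
        unfolding S_def using closure_subset by fast
    qed
    then show ?thesis
      using surj by (metis UNIV_eq_I surjD)
  qed
  have "\<exists>n. interior (S n) \<noteq> {}"
  proof (rule ccontr)
    assume "\<nexists>n. interior (S n) \<noteq> {}"
    then have "euclidean interior_of \<Union>(range S) = {}"
      by (intro Baire_category_alt) (auto simp: S_def completely_metrizable_space_euclidean)
    then show False
      using cover by simp
  qed
  then obtain n y0 \<epsilon> where eps: "0 < \<epsilon>" "cball y0 \<epsilon> \<subseteq> S n"
    by (auto simp: mem_interior_cball)
  \<comment> \<open>Differences of approximants of \<open>y0 + v\<close> and of \<open>y0\<close> approximate \<open>v\<close>.\<close>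
  have near_zero: "\<exists>x. norm x \<le> 2 * real n \<and> norm (v - f x) < \<delta>"
    if v: "norm v \<le> \<epsilon>" and "0 < \<delta>" for v \<delta>
  proof -
    have approx: "\<exists>x. norm x \<le> real n \<and> norm (w - f x) < \<delta> / 2" if "w \<in> cball y0 \<epsilon>" for w
    proof -
      have "w \<in> closure (f ` cball 0 (real n))"
        using that eps(2) by (auto simp: S_def)
      then show ?thesis
        using \<open>0 < \<delta>\<close> unfolding closure_approachable
        by (auto simp: dist_norm norm_minus_commute dest!: spec[of _ "\<delta> / 2"])
    qed
    obtain x1 where x1: "norm x1 \<le> real n" "norm (y0 + v - f x1) < \<delta> / 2"
      using approx[of "y0 + v"] v by (auto simp: dist_norm)
    obtain x2 where x2: "norm x2 \<le> real n" "norm (y0 - f x2) < \<delta> / 2"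
      using approx[of y0] eps(1) by auto
    have "norm (v - f (x1 - x2)) = norm ((y0 + v - f x1) - (y0 - f x2))"
      by (simp add: f.diff algebra_simps)
    also have "\<dots> < \<delta>"
      using norm_triangle_ineq4[of "y0 + v - f x1" "y0 - f x2"] x1 x2 by linarith
    finally show ?thesis
      using norm_triangle_ineq4[of x1 x2] x1 x2 by (intro exI[of _ "x1 - x2"]) auto
  qed
  show thesis
  proof
    show "0 \<le> 2 * real n / \<epsilon>"
      using eps by simp
    fix y :: 'b
    show "\<exists>x. norm x \<le> 2 * real n / \<epsilon> * norm y \<and> norm (y - f x) \<le> norm y / 2"
    proof (cases "y = 0")
      case True
      then show ?thesis
        by (intro exI[of _ 0]) simp
    next
      case False
      define c where "c = norm y / \<epsilon>"
      have c: "0 < c" "norm y = c * \<epsilon>"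
        using False eps by (auto simp: c_def)
      obtain x where x: "norm x \<le> 2 * real n" "norm (y /\<^sub>R c - f x) < \<epsilon> / 2"
        using near_zero[of "y /\<^sub>R c" "\<epsilon> / 2"] c eps by (auto simp: field_simps)
      have "y - f (c *\<^sub>R x) = c *\<^sub>R (y /\<^sub>R c - f x)"
        using c by (simp add: f.scaleR scaleR_diff_right)
      then have "norm (y - f (c *\<^sub>R x)) \<le> norm y / 2"
        using x c by (simp add: mult_left_mono order_less_imp_le)
      moreover have "norm (c *\<^sub>R x) \<le> 2 * real n / \<epsilon> * norm y"
        using mult_left_mono[OF x(1), of c] c eps by (simp add: mult.commute)
      ultimately show ?thesis
        by blast
    qed
  qed
qed

text \<open>Approximate preimages are corrected successively: each remainder has at most half the norm of the
  preceding one, so the corrections sum to an exact preimage of norm at most \<open>2 * C * norm y\<close>.\<close>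

theorem bounded_inverse_theorem:
  fixes f :: "'a::banach \<Rightarrow> 'b::banach"
  assumes f: "bounded_linear f" and bij: "bij f"
  shows "bounded_linear (inv f)"
proof -
  interpret f: bounded_linear f by (rule f)
  have inv_eq: "inv f y = x" if "f x = y" for x y
    using bij that by (metis bij_inv_eq_iff)
  have f_inv: "f (inv f y) = y" for y
    using bij by (simp add: bij_is_surj surj_f_inv_f)
  obtain C where C: "0 \<le> C" "\<And>y. \<exists>x. norm x \<le> C * norm y \<and> norm (y - f x) \<le> norm y / 2"
    using approximate_preimages[OF f bij_is_surj[OF bij]] by blast
  then obtain g where g: "\<And>y. norm (g y) \<le> C * norm y" "\<And>y. norm (y - f (g y)) \<le> norm y / 2"
    by metis
  have bound: "norm (inv f y) \<le> norm y * (2 * C)" for y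
  proof -
    define r where "r = (\<lambda>k. ((\<lambda>v. v - f (g v)) ^^ k) y)"
    have r_Suc: "r (Suc k) = r k - f (g (r k))" for k
      by (simp add: r_def)
    have r: "norm (r k) \<le> norm y * (1/2) ^ k" for k
    proof (induction k)
      case (Suc k)
      then show ?case
        using g(2)[of "r k"] by (simp add: r_Suc)
    qed (simp add: r_def)
    have geo: "(\<lambda>k. C * norm y * (1/2) ^ k) sums (C * norm y * 2)"
      using sums_mult[OF geometric_sums[of "1/2::real"], of "C * norm y"] by simp
    have gk: "norm (g (r k)) \<le> C * norm y * (1/2) ^ k" for k
      using g(1)[of "r k"] mult_left_mono[OF r C(1), of k] by (simp add: mult.assoc)
    have norm_summable: "summable (\<lambda>k. norm (g (r k)))"
      by (rule summable_comparison_test'[OF sums_summable[OF geo]]) (use gk in auto)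
    then have summable: "summable (\<lambda>k. g (r k))"
      by (rule summable_norm_cancel)
    have partial: "(\<Sum>k<n. f (g (r k))) = y - r n" for n
      by (induction n) (simp_all add: r_Suc, simp add: r_def)
    have "r \<longlonglongrightarrow> 0"
    proof (rule Lim_null_comparison)
      show "(\<lambda>k. norm y * (1/2) ^ k) \<longlonglongrightarrow> 0"
        by (intro tendsto_mult_right_zero LIMSEQ_power_zero) simp
    qed (use r in auto)
    then have "(\<lambda>n. y - r n) \<longlonglongrightarrow> y"
      using tendsto_diff[OF tendsto_const, of r 0 sequentially y] by simp
    then have "(\<lambda>k. f (g (r k))) sums y"
      by (simp add: sums_def partial)
    moreover have "(\<lambda>k. f (g (r k))) sums f (\<Sum>k. g (r k))"
      by (intro f.sums summable_sums summable)
    ultimately have "inv f y = (\<Sum>k. g (r k))"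
      by (intro inv_eq) (metis sums_unique2)
    moreover have "norm (\<Sum>k. g (r k)) \<le> (\<Sum>k. C * norm y * (1/2) ^ k)"
      using summable_norm[OF norm_summable] suminf_le[OF gk norm_summable sums_summable[OF geo]]
      by linarith
    ultimately show ?thesis
      using sums_unique[OF geo] by (simp add: algebra_simps)
  qed
  show ?thesis
  proof (rule bounded_linear_intro[OF _ _ bound])
    show "inv f (x + y) = inv f x + inv f y" for x y
      by (rule inv_eq) (simp add: f.add f_inv)
    show "inv f (r *\<^sub>R x) = r *\<^sub>R inv f x" for r x
      by (rule inv_eq) (simp add: f.scaleR f_inv)
  qed
qed

section \<open>Norming functionals\<close>

text \<open>The Hahn--Banach argument used here works with everywhere defined sublinear functionals instead
  of partially defined linear ones: linear functionals are exactly the minimal sublinear ones, and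
  Zorn's lemma supplies a minimal one below any given one.\<close>

definition sublinear :: "('a::real_vector \<Rightarrow> real) \<Rightarrow> bool"
  where "sublinear q \<longleftrightarrow>
    (\<forall>x y. q (x + y) \<le> q x + q y) \<and> (\<forall>r x. 0 \<le> r \<longrightarrow> q (r *\<^sub>R x) = r * q x)"

lemma sublinear_add: "sublinear q \<Longrightarrow> q (x + y) \<le> q x + q y"
  and sublinear_scale: "sublinear q \<Longrightarrow> 0 \<le> r \<Longrightarrow> q (r *\<^sub>R x) = r * q x"
  by (auto simp: sublinear_def)

lemma sublinear_zero: "sublinear q \<Longrightarrow> q 0 = 0"
  using sublinear_scale[of q 0 0] by simp

lemma sublinear_minus: "sublinear q \<Longrightarrow> - q (- x) \<le> q x"
  using sublinear_add[of q x "- x"] sublinear_zero[of q] by simp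

lemma sublinear_norm: "sublinear (norm :: 'a::real_normed_vector \<Rightarrow> real)"
  by (simp add: sublinear_def norm_triangle_ineq)

lemma le_cINF_add:
  fixes f g :: "_ \<Rightarrow> real"
  assumes "A \<noteq> {}" "B \<noteq> {}" "\<And>s t. s \<in> A \<Longrightarrow> t \<in> B \<Longrightarrow> c \<le> f s + g t"
  shows "c \<le> (INF s\<in>A. f s) + (INF t\<in>B. g t)"
proof -
  have "c - f s \<le> (INF t\<in>B. g t)" if "s \<in> A" for s
    using assms that by (intro cINF_greatest) (auto simp: algebra_simps)
  then have "c - (INF t\<in>B. g t) \<le> (INF s\<in>A. f s)"
    using assms by (intro cINF_greatest) (auto simp: algebra_simps)
  then show ?thesis
    by simp
qed

text \<open>One construction serves two purposes: it is the starting point of the extension argument, with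
  \<open>q\<close> the norm, and it forces a minimal sublinear functional to be odd.  The functional \<open>p\<close> is the
  largest sublinear one below \<open>q\<close> whose value at \<open>- y\<close> is at most \<open>- q y\<close>.\<close>

lemma sublinear_lower:
  fixes q :: "'a::real_vector \<Rightarrow> real"
  assumes q: "sublinear q"
  obtains p where "sublinear p" "\<And>x. p x \<le> q x" "p (- y) \<le> - q y"
proof -
  define p where "p = (\<lambda>x. INF t\<in>{0..}. q (x + t *\<^sub>R y) - t * q y)"
  have bdd: "bdd_below ((\<lambda>t. q (x + t *\<^sub>R y) - t * q y) ` {0..})" for x
  proof (rule bdd_belowI2)
    fix t :: real
    assume "t \<in> {0..}"
    then show "- q (- x) \<le> q (x + t *\<^sub>R y) - t * q y"
      using sublinear_add[OF q, of "- x" "x + t *\<^sub>R y"] sublinear_scale[OF q, of t y] by simp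
  qed
  have le: "p x \<le> q (x + t *\<^sub>R y) - t * q y" if "0 \<le> t" for x t
    unfolding p_def using that by (intro cINF_lower bdd) auto
  have scale_le: "p (r *\<^sub>R x) \<le> r * p x" if "0 < r" for r x
  proof -
    have "p (r *\<^sub>R x) / r \<le> p x"
      unfolding p_def
    proof (intro cINF_greatest)
      fix t :: real
      assume t: "t \<in> {0..}"
      have "r *\<^sub>R x + (r * t) *\<^sub>R y = r *\<^sub>R (x + t *\<^sub>R y)"
        by (simp add: scaleR_add_right)
      then have "p (r *\<^sub>R x) \<le> r * (q (x + t *\<^sub>R y) - t * q y)"
        using le[of "r * t" "r *\<^sub>R x"] t that sublinear_scale[OF q, of r "x + t *\<^sub>R y"]
        by (simp add: algebra_simps)
      then show "(INF t\<in>{0..}. q (r *\<^sub>R x + t *\<^sub>R y) - t * q y) / r \<le> q (x + t *\<^sub>R y) - t * q y"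
        using that by (simp add: p_def field_simps)
    qed simp
    then show ?thesis
      using that by (simp add: field_simps)
  qed
  have p0: "p 0 = 0"
  proof (rule antisym)
    show "p 0 \<le> 0"
      using le[of 0 0] sublinear_zero[OF q] by simp
    show "0 \<le> p 0"
      unfolding p_def by (intro cINF_greatest) (auto simp: sublinear_scale[OF q])
  qed
  show thesis
  proof
    show "p x \<le> q x" for x
      using le[of 0 x] by simp
    show "p (- y) \<le> - q y"
      using le[of 1 "- y"] sublinear_zero[OF q] by simp
    have "p (x + z) \<le> p x + p z" for x z
      unfolding p_def
    proof (rule le_cINF_add)
      fix s t :: real
      assume st: "s \<in> {0..}" "t \<in> {0..}"
      have "x + z + (s + t) *\<^sub>R y = (x + s *\<^sub>R y) + (z + t *\<^sub>R y)"
        by (simp add: scaleR_add_left)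
      then have "p (x + z) \<le> (q (x + s *\<^sub>R y) - s * q y) + (q (z + t *\<^sub>R y) - t * q y)"
        using le[of "s + t" "x + z"] st sublinear_add[OF q, of "x + s *\<^sub>R y" "z + t *\<^sub>R y"]
        by (simp add: algebra_simps)
      then show "(INF t\<in>{0..}. q (x + z + t *\<^sub>R y) - t * q y)
          \<le> (q (x + s *\<^sub>R y) - s * q y) + (q (z + t *\<^sub>R y) - t * q y)"
        by (simp add: p_def)
    qed auto
    moreover have "p (r *\<^sub>R x) = r * p x" if "0 \<le> r" for r x
    proof (cases "r = 0")
      case False
      with that have "0 < r"
        by simp
      then have "r * p (inverse r *\<^sub>R r *\<^sub>R x) \<le> r * (inverse r * p (r *\<^sub>R x))"
        by (intro mult_left_mono scale_le) auto
      then have "r * p x \<le> p (r *\<^sub>R x)"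
        using \<open>0 < r\<close> by (simp add: field_simps)
      then show ?thesis
        using scale_le[OF \<open>0 < r\<close>, of x] by linarith
    qed (simp add: p0)
    ultimately show "sublinear p"
      by (simp add: sublinear_def)
  qed
qed

text \<open>Minimality rules out any proper lowering, so \<open>q (- x) = - q x\<close>; subadditivity at \<open>x, y\<close> and at
  \<open>- x, - y\<close> then gives additivity.\<close>

lemma minimal_sublinear_is_linear:
  assumes q: "sublinear q" and minimal: "\<And>p. sublinear p \<Longrightarrow> (\<And>x. p x \<le> q x) \<Longrightarrow> p = q"
  shows "linear q"
proof -
  have odd: "q (- x) = - q x" for x
  proof -
    obtain p where p: "sublinear p" "\<And>x. p x \<le> q x" "p (- x) \<le> - q x"
      using sublinear_lower[OF q] by blast
    then have "q (- x) \<le> - q x"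
      using minimal[of p] by auto
    then show ?thesis
      using sublinear_minus[OF q, of x] by linarith
  qed
  have add: "q (x + y) = q x + q y" for x y
    using sublinear_add[OF q, of x y] sublinear_add[OF q, of "- x" "- y"] odd[of "x + y"] odd[of x] odd[of y]
    by simp
  have "q (r *\<^sub>R x) = r * q x" for r x
  proof (cases "0 \<le> r")
    case False
    then show ?thesis
      using sublinear_scale[OF q, of "- r" x] odd[of "r *\<^sub>R x"] by simp
  qed (rule sublinear_scale[OF q])
  with add show ?thesis
    by (intro linearI) auto
qed

text \<open>The pointwise infimum of a chain is finite because every \<open>q\<close> below \<open>q0\<close> satisfies
  \<open>- q0 (- x) \<le> q x\<close>; it is subadditive because two members of a chain can be replaced by the smaller
  one.\<close>

lemma ex_minimal_sublinear:
  fixes q0 :: "'a::real_vector \<Rightarrow> real"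
  assumes q0: "sublinear q0"
  obtains q where "sublinear q" "\<And>x. q x \<le> q0 x"
    "\<And>p. sublinear p \<Longrightarrow> (\<And>x. p x \<le> q x) \<Longrightarrow> p = q"
proof -
  define A where "A = {q. sublinear q \<and> (\<forall>x. q x \<le> q0 x)}"
  define below :: "('a \<Rightarrow> real) \<Rightarrow> ('a \<Rightarrow> real) \<Rightarrow> bool" where "below = (\<lambda>q p. p \<le> q)"
  have "\<exists>m\<in>A. \<forall>a\<in>A. below m a \<longrightarrow> a = m"
  proof (rule predicate_Zorn)
    show "partial_order_on A (relation_of below A)"
      by (intro partial_order_on_relation_ofI) (auto simp: below_def)
    fix C
    assume C: "C \<in> Chains (relation_of below A)"
    have CA: "C \<subseteq> A"
      using C by (auto simp: Chains_def relation_of_def)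
    have chain: "p \<le> q \<or> q \<le> p" if "p \<in> C" "q \<in> C" for p q
      using C that by (auto simp: Chains_def relation_of_def below_def)
    show "\<exists>u\<in>A. \<forall>a\<in>C. below a u"
    proof (cases "C = {}")
      case True
      then show ?thesis
        using q0 by (auto simp: A_def)
    next
      case False
      define u where "u = (\<lambda>x. INF q\<in>C. q x)"
      have bdd: "bdd_below ((\<lambda>q. q x) ` C)" for x
      proof (rule bdd_belowI2)
        fix q
        assume "q \<in> C"
        then have "sublinear q" "q (- x) \<le> q0 (- x)"
          using CA by (auto simp: A_def)
        then show "- q0 (- x) \<le> q x"
          using sublinear_minus[of q x] by linarith
      qed
      have le: "u x \<le> q x" if "q \<in> C" for q x
        unfolding u_def using that by (intro cINF_lower bdd)
      have "u (x + y) \<le> u x + u y" for x y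
        unfolding u_def
      proof (rule le_cINF_add[OF False False])
        fix p q
        assume pq: "p \<in> C" "q \<in> C"
        then have sub: "sublinear p" "sublinear q"
          using CA by (auto simp: A_def)
        have "u (x + y) \<le> p x + q y"
          using chain[OF pq]
        proof
          assume "p \<le> q"
          then show ?thesis
            using le[OF pq(1), of "x + y"] sublinear_add[OF sub(1), of x y] le_funD[of p q y] by linarith
        next
          assume "q \<le> p"
          then show ?thesis
            using le[OF pq(2), of "x + y"] sublinear_add[OF sub(2), of x y] le_funD[of q p x] by linarith
        qed
        then show "(INF q\<in>C. q (x + y)) \<le> p x + q y"
          by (simp add: u_def)
      qed
      moreover have "u (r *\<^sub>R x) = r * u x" if "0 \<le> r" for r x
      proof -
        have "(\<lambda>q. q (r *\<^sub>R x)) ` C = (\<lambda>q. r * q x) ` C"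
        proof (intro image_cong refl)
          fix q
          assume "q \<in> C"
          then have "sublinear q"
            using CA by (auto simp: A_def)
          then show "q (r *\<^sub>R x) = r * q x"
            by (rule sublinear_scale[OF _ that])
        qed
        then have "u (r *\<^sub>R x) = (INF q\<in>C. r * q x)"
          by (simp add: u_def)
        also have "\<dots> = r * u x"
        proof -
          have "mono ((*) r)"
            using that by (intro monoI mult_left_mono)
          then have "r * Inf ((\<lambda>q. q x) ` C) = Inf ((*) r ` (\<lambda>q. q x) ` C)"
            using False bdd[of x]
            by (intro continuous_at_Inf_mono) (auto intro: continuous_intros)
          then show ?thesis
            by (simp add: u_def image_image)
        qed
        finally show ?thesis .
      qed
      ultimately have "sublinear u"
        by (simp add: sublinear_def)
      moreover have "u x \<le> q0 x" for x
      proof -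
        obtain q where "q \<in> C"
          using False by blast
        then have "u x \<le> q x" "q x \<le> q0 x"
          using le CA by (auto simp: A_def)
        then show ?thesis
          by (rule order_trans)
      qed
      ultimately show ?thesis
        using le by (intro bexI[of _ u]) (auto simp: A_def below_def le_fun_def)
    qed
  qed
  then obtain m where m: "m \<in> A" "\<And>a. a \<in> A \<Longrightarrow> a \<le> m \<Longrightarrow> a = m"
    by (auto simp: below_def)
  show thesis
  proof
    show "sublinear m" "\<And>x. m x \<le> q0 x"
      using m(1) by (auto simp: A_def)
    fix p
    assume p: "sublinear p" "\<And>x. p x \<le> m x"
    moreover have "p x \<le> q0 x" for x
      using p(2)[of x] m(1) order_trans[of "p x" "m x" "q0 x"] by (simp add: A_def)
    ultimately show "p = m"
      by (intro m(2)) (simp_all add: A_def le_fun_def)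
  qed
qed

lemma real_norming_functional:
  fixes x :: "'a::real_normed_vector"
  obtains u where "linear u" "\<And>y. u y \<le> norm y" "u x = norm x"
proof -
  obtain p where p: "sublinear p" "\<And>y. p y \<le> norm y" "p (- x) \<le> - norm x"
    using sublinear_lower[OF sublinear_norm] by blast
  obtain u where u: "sublinear u" "\<And>y. u y \<le> p y"
    "\<And>p. sublinear p \<Longrightarrow> (\<And>x. p x \<le> u x) \<Longrightarrow> p = u"
    using ex_minimal_sublinear[OF p(1)] by blast
  have lin: "linear u"
    using minimal_sublinear_is_linear u by blast
  have le: "u y \<le> norm y" for y
    using u(2)[of y] p(2)[of y] by linarith
  have "norm x \<le> u x"
    using u(2)[of "- x"] p(3) linear_neg[OF lin, of x] by simp
  then show thesis
    by (intro that[OF lin le] antisym le)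
qed

text \<open>A real norming functional \<open>u\<close> is the real part of the complex-linear functional
  \<open>y \<mapsto> u y - \<i> u (\<i> y)\<close>.  Rotating \<open>y\<close> so that the value becomes real shows that the norm bound is
  inherited.\<close>

lemma complex_norming_functional:
  fixes x :: "'a::complex_banach"
  obtains \<phi> :: "'a \<Rightarrow>\<^sub>L complex" where "\<And>z y. \<phi> (z *\<^sub>C y) = z * \<phi> y"
    "\<And>y. cmod (\<phi> y) \<le> norm y" "\<phi> x = norm x"
proof -
  obtain u where lin: "linear u" and le: "\<And>y. u y \<le> norm y" and ux: "u x = norm x"
    using real_norming_functional[of x] by blast
  define f where "f = (\<lambda>y. complex_of_real (u y) - \<i> * complex_of_real (u (\<i> *\<^sub>C y)))"
  have add: "f (y + y') = f y + f y'" for y y'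
    by (simp add: f_def linear_add[OF lin] scaleC_add_right algebra_simps)
  have u_scaleC: "u (z *\<^sub>C y) = Re z * u y + Im z * u (\<i> *\<^sub>C y)" for z y
  proof -
    have "z *\<^sub>C y = complex_of_real (Re z) *\<^sub>C y + (complex_of_real (Im z) * \<i>) *\<^sub>C y"
      by (subst complex_eq[of z]) (simp add: scaleC_add_left mult.commute)
    also have "\<dots> = Re z *\<^sub>R y + Im z *\<^sub>R \<i> *\<^sub>C y"
      by (simp only: scaleC_of_real flip: scaleC_scaleC)
    finally show ?thesis
      by (simp add: linear_add[OF lin] linear_cmul[OF lin])
  qed
  have scale: "f (z *\<^sub>C y) = z * f y" for z y
    using u_scaleC[of z y] u_scaleC[of "\<i> * z" y]
    by (simp add: f_def scaleC_scaleC complex_eq_iff)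
  have bound: "cmod (f y) \<le> norm y" for y
  proof (cases "f y = 0")
    case False
    define w where "w = cnj (sgn (f y))"
    have w: "cmod w = 1" "w * f y = cmod (f y)"
      using False complex_norm_square[of "f y"]
      by (simp_all add: w_def norm_divide sgn_eq power2_eq_square field_simps)
    have "cmod (f y) = Re (f (w *\<^sub>C y))"
      by (simp add: scale w)
    also have "\<dots> = u (w *\<^sub>C y)"
      by (simp add: f_def)
    also have "\<dots> \<le> norm y"
      using le[of "w *\<^sub>C y"] by (simp add: norm_scaleC w)
    finally show ?thesis .
  qed simp
  have "bounded_linear f"
  proof (rule bounded_linear_intro[where K = 1])
    show "f (r *\<^sub>R y) = r *\<^sub>R f y" for r y
      using scale[of "complex_of_real r" y] by (simp add: scaleC_of_real scaleR_conv_of_real)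
  qed (use add bound in auto)
  then have app: "blinfun_apply (Blinfun f) = f"
    by (rule bounded_linear_Blinfun_apply)
  have "Re (f x) = norm x"
    by (simp add: f_def ux)
  moreover from this have "Im (f x) = 0"
    using power_mono[OF bound[of x] norm_ge_zero, of 2] cmod_power2[of "f x"] by simp
  ultimately have "f x = norm x"
    by (simp add: complex_eq_iff)
  show thesis
    by (rule that[of "Blinfun f"]; unfold app) (fact scale bound \<open>f x = norm x\<close>)+
qed

section \<open>Invertible elements and resolvents\<close>

lemma scaleC_one: "1 *\<^sub>C x = (x::'a::complex_banach)"
  using scaleC_of_real[of 1 x] by simp

lemma scaleC_minus_one: "(-1) *\<^sub>C x = - (x::'a::complex_banach)"
  using scaleC_of_real[of "-1" x] by simp

lemma bounded_linear_scaleC_left: "bounded_linear (\<lambda>z. z *\<^sub>C (x::'a::complex_banach))"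
proof (rule bounded_linear_intro[where K = "norm x"])
  show "(r *\<^sub>R z) *\<^sub>C x = r *\<^sub>R z *\<^sub>C x" for r z
    by (simp add: scaleR_conv_of_real scaleC_of_real flip: scaleC_scaleC)
qed (simp_all add: scaleC_add_left norm_scaleC)

lemmas scaleC_diff_left = linear_diff[OF bounded_linear.linear[OF bounded_linear_scaleC_left]]
lemmas scaleC_minus_left = linear_neg[OF bounded_linear.linear[OF bounded_linear_scaleC_left]]
lemmas scaleC_zero_left = linear_0[OF bounded_linear.linear[OF bounded_linear_scaleC_left]]

lemma inverse_of_eq:
  assumes "u * v = 1" "v * u = 1"
  shows "inverse_of u = v"
  unfolding inverse_of_def
proof (rule the_equality)
  show "u * v = 1 \<and> v * u = 1"
    using assms by simp
  fix w
  assume w: "u * w = 1 \<and> w * u = 1"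
  have "w = (v * u) * w"
    by (simp add: assms)
  also have "\<dots> = v * (u * w)"
    by (rule mult.assoc)
  finally show "w = v"
    using w by simp
qed

lemma inverse_of_inverse:
  assumes "is_invertible u"
  shows "u * inverse_of u = 1" "inverse_of u * u = 1"
  using assms inverse_of_eq by (auto simp: is_invertible_def)

lemma is_invertible_mult:
  assumes "is_invertible u" "is_invertible v"
  shows "is_invertible (u * v)"
proof -
  have "u * v * (inverse_of v * inverse_of u) = u * (v * inverse_of v) * inverse_of u"
    "inverse_of v * inverse_of u * (u * v) = inverse_of v * (inverse_of u * u) * v"
    by (simp_all only: mult.assoc)
  then have "u * v * (inverse_of v * inverse_of u) = 1 \<and> inverse_of v * inverse_of u * (u * v) = 1"
    using assms by (simp add: inverse_of_inverse)
  then show ?thesis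
    unfolding is_invertible_def by blast
qed

text \<open>A left and a right inverse of \<open>d\<close> are \<open>v * d\<close> and \<open>d * v\<close>, where \<open>v\<close> is the inverse of the square;
  they therefore coincide.\<close>

lemma is_invertible_factor:
  assumes "is_invertible (d * d)"
  shows "is_invertible d"
proof -
  obtain v where v: "d * d * v = 1" "v * (d * d) = 1"
    using assms by (auto simp: is_invertible_def)
  have "v * d = v * d * (d * d * v)"
    by (simp add: v)
  also have "\<dots> = v * (d * d) * (d * v)"
    by (simp only: mult.assoc)
  also have "\<dots> = d * v"
    by (simp add: v)
  finally have "v * d = d * v" .
  then have "d * (d * v) = 1 \<and> d * v * d = 1"
    using v by (simp add: mult.assoc)
  then show ?thesis
    unfolding is_invertible_def by blast
qed

lemma norm_power_le_norm_one:
  fixes x :: "'a::complex_unital_banach_algebra"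
  shows "norm (x ^ n) \<le> norm (1::'a) * norm x ^ n"
proof (induction n)
  case (Suc n)
  have "norm (x ^ Suc n) \<le> norm x * norm (x ^ n)"
    by (simp add: norm_mult_ineq)
  also have "\<dots> \<le> norm x * (norm (1::'a) * norm x ^ n)"
    by (intro mult_left_mono Suc) simp
  finally show ?case
    by (simp add: mult_ac)
qed simp

text \<open>The inverse is the Neumann series.\<close>

lemma is_invertible_one_minus:
  fixes x :: "'a::complex_unital_banach_algebra"
  assumes "norm x < 1"
  shows "is_invertible (1 - x)"
proof -
  have summable: "summable (\<lambda>n. x ^ n)"
    by (rule summable_comparison_test'[OF summable_mult[OF summable_geometric]])
      (use assms norm_power_le_norm_one[of x] in auto)
  define S where "S = (\<Sum>n. x ^ n)"
  have head: "(\<Sum>n. x ^ Suc n) = S - 1"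
    using suminf_split_head[OF summable] by (simp add: S_def)
  have "x * S = S - 1"
    using suminf_mult[OF summable, of x] head by (simp add: S_def)
  moreover have "S * x = S - 1"
    using suminf_mult2[OF summable, of x] head by (simp add: S_def power_commutes)
  ultimately have "(1 - x) * S = 1" "S * (1 - x) = 1"
    by (simp_all add: algebra_simps)
  then show ?thesis
    by (auto simp: is_invertible_def)
qed

lemma is_invertible_perturbation:
  fixes u x :: "'a::complex_unital_banach_algebra"
  assumes u: "is_invertible u" and small: "norm (inverse_of u) * norm x < 1"
  shows "is_invertible (u - x)"
proof -
  have "u - x = u * (1 - inverse_of u * x)"
    using u by (simp add: right_diff_distrib inverse_of_inverse flip: mult.assoc)
  moreover have "norm (inverse_of u * x) < 1"
    using norm_mult_ineq small by (rule le_less_trans)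
  ultimately show ?thesis
    using is_invertible_mult[OF u is_invertible_one_minus] by simp
qed

definition resolvent_set :: "'a::complex_unital_banach_algebra \<Rightarrow> complex set"
  where "resolvent_set a = {z. is_invertible (a - z *\<^sub>C 1)}"

definition resolvent :: "'a::complex_unital_banach_algebra \<Rightarrow> complex \<Rightarrow> 'a"
  where "resolvent a z = inverse_of (a - z *\<^sub>C 1)"

lemma resolvent_mult:
  assumes "z \<in> resolvent_set a"
  shows "(a - z *\<^sub>C 1) * resolvent a z = 1" "resolvent a z * (a - z *\<^sub>C 1) = 1"
  using assms by (auto simp: resolvent_set_def resolvent_def inverse_of_inverse)

lemma open_resolvent_set: "open (resolvent_set (a :: 'a::complex_unital_banach_algebra))"
proof (unfold open_dist, intro ballI)
  fix z
  assume z: "z \<in> resolvent_set a"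
  define K where "K = norm (resolvent a z) * norm (1::'a) + 1"
  have K: "0 < K"
    by (simp add: K_def add_nonneg_pos)
  have "w \<in> resolvent_set a" if "dist w z < 1 / K" for w
  proof -
    have "norm (resolvent a z) * norm ((w - z) *\<^sub>C (1::'a)) \<le> cmod (w - z) * K"
      by (simp add: K_def norm_scaleC algebra_simps)
    also have "\<dots> < 1"
      using that K by (simp add: dist_norm field_simps)
    finally have "is_invertible (a - z *\<^sub>C 1 - (w - z) *\<^sub>C 1)"
      using z unfolding resolvent_set_def resolvent_def
      by (intro is_invertible_perturbation[of "a - z *\<^sub>C 1"]) auto
    then show ?thesis
      by (simp add: resolvent_set_def scaleC_diff_left)
  qed
  then show "\<exists>\<epsilon>>0. \<forall>w. dist w z < \<epsilon> \<longrightarrow> w \<in> resolvent_set a"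
    using K by (intro exI[of _ "1 / K"]) auto
qed

lemma resolvent_identity:
  fixes a :: "'a::complex_unital_banach_algebra"
  assumes "z \<in> resolvent_set a" "w \<in> resolvent_set a"
  shows "resolvent a z - resolvent a w = (z - w) *\<^sub>C (resolvent a z * resolvent a w)"
proof -
  let ?R = "resolvent a z" and ?Q = "resolvent a w"
  have "?R - ?Q = ?R * ((a - w *\<^sub>C 1) * ?Q) - (?R * (a - z *\<^sub>C 1)) * ?Q"
    using assms by (simp add: resolvent_mult)
  also have "\<dots> = ?R * ((a - w *\<^sub>C 1) - (a - z *\<^sub>C 1)) * ?Q"
    by (simp add: algebra_simps)
  also have "(a - w *\<^sub>C 1) - (a - z *\<^sub>C 1) = (z - w) *\<^sub>C 1"
    by (simp add: scaleC_diff_left)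
  finally show ?thesis
    by (simp add: mult_scaleC_left mult_scaleC_right)
qed

text \<open>The resolvent identity first bounds \<open>resolvent a z\<close> by \<open>2 * norm (resolvent a w)\<close> for \<open>z\<close> near
  \<open>w\<close>, and then bounds the difference.\<close>

lemma resolvent_tendsto:
  fixes a :: "'a::complex_unital_banach_algebra"
  assumes w: "w \<in> resolvent_set a"
  shows "resolvent a \<midarrow>w\<rightarrow> resolvent a w"
proof -
  define r where "r = norm (resolvent a w)"
  have near: "\<forall>\<^sub>F z in at w. z \<in> resolvent_set a"
    using open_resolvent_set w by (rule eventually_at_in_open')
  have "((\<lambda>z. cmod (z - w) * r) \<longlongrightarrow> 0) (at w)"
    by (rule tendsto_eq_intros refl | simp)+
  then have small: "\<forall>\<^sub>F z in at w. cmod (z - w) * r < 1 / 2"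
    by (rule order_tendstoD) simp
  have "\<forall>\<^sub>F z in at w. norm (resolvent a z - resolvent a w) \<le> cmod (z - w) * (2 * r * r)"
    using near small
  proof eventually_elim
    case (elim z)
    let ?R = "resolvent a z"
    have diff: "norm (?R - resolvent a w) \<le> cmod (z - w) * (norm ?R * r)"
      using resolvent_identity[OF elim(1) w] norm_mult_ineq[of ?R "resolvent a w"]
      by (simp add: norm_scaleC r_def mult_left_mono)
    have "norm ?R \<le> r + cmod (z - w) * (norm ?R * r)"
      using diff norm_triangle_ineq2[of ?R "resolvent a w"] by (simp add: r_def)
    also have "cmod (z - w) * (norm ?R * r) \<le> norm ?R * (1 / 2)"
      using mult_left_mono[OF less_imp_le[OF elim(2)], of "norm ?R"] by (simp add: mult_ac)
    finally have "norm ?R \<le> 2 * r"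
      by simp
    then have "cmod (z - w) * (norm ?R * r) \<le> cmod (z - w) * (2 * r * r)"
      by (intro mult_left_mono mult_right_mono) (auto simp: r_def)
    with diff show ?case
      by linarith
  qed
  moreover have "((\<lambda>z. cmod (z - w) * (2 * r * r)) \<longlongrightarrow> 0) (at w)"
    by (rule tendsto_eq_intros refl | simp)+
  ultimately have "((\<lambda>z. resolvent a z - resolvent a w) \<longlongrightarrow> 0) (at w)"
    by (rule Lim_null_comparison)
  then show ?thesis
    by (rule LIM_zero_cancel)
qed

lemma resolvent_bound:
  fixes a :: "'a::complex_unital_banach_algebra"
  assumes z: "z \<in> resolvent_set a" and large: "norm a < cmod z"
  shows "norm (resolvent a z) \<le> norm (1::'a) / (cmod z - norm a)"
proof -
  have "z *\<^sub>C resolvent a z = a * resolvent a z - 1"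
    using resolvent_mult(1)[OF z] by (simp add: algebra_simps mult_scaleC_left)
  then have "cmod z * norm (resolvent a z) = norm (a * resolvent a z - 1)"
    using norm_scaleC[of z "resolvent a z"] by simp
  also have "\<dots> \<le> norm a * norm (resolvent a z) + norm (1::'a)"
    using norm_triangle_ineq4[of "a * resolvent a z" 1] norm_mult_ineq[of a "resolvent a z"] by linarith
  finally show ?thesis
    using large by (simp add: field_simps)
qed

lemma holomorphic_on_resolvent:
  fixes a :: "'a::complex_unital_banach_algebra" and \<psi> :: "'a \<Rightarrow> complex"
  assumes lin: "bounded_linear \<psi>" and scale: "\<And>z x. \<psi> (z *\<^sub>C x) = z * \<psi> x"
  shows "(\<lambda>z. \<psi> (resolvent a z)) holomorphic_on resolvent_set a"
proof (subst holomorphic_on_open[OF open_resolvent_set], intro ballI exI)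
  interpret \<psi>: bounded_linear \<psi> by (rule lin)
  fix w
  assume w: "w \<in> resolvent_set a"
  have "((\<lambda>z. \<psi> (resolvent a z * resolvent a w)) \<longlongrightarrow> \<psi> (resolvent a w * resolvent a w)) (at w)"
    by (intro \<psi>.tendsto tendsto_mult resolvent_tendsto w tendsto_const)
  moreover have "\<forall>\<^sub>F z in at w. \<psi> (resolvent a z * resolvent a w)
      = (\<psi> (resolvent a z) - \<psi> (resolvent a w)) / (z - w)"
    using eventually_at_in_open'[OF open_resolvent_set w] eventually_neq_at_within[of w w UNIV]
  proof eventually_elim
    case (elim z)
    then show ?case
      using resolvent_identity[OF elim(1) w] scale[of "z - w" "resolvent a z * resolvent a w"]
      by (simp flip: \<psi>.diff)
  qed
  ultimately show "((\<lambda>z. \<psi> (resolvent a z)) has_field_derivative \<psi> (resolvent a w * resolvent a w)) (at w)"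
    unfolding has_field_derivative_iff by (rule Lim_transform_eventually)
qed

section \<open>Intertwiners of elements with disjoint spectra\<close>

text \<open>This is Rosenblum's theorem.  Where both resolvents exist, \<open>resolvent a z * x\<close> and
  \<open>x * resolvent b z\<close> agree.  As at every point at least one of them exists, they glue to an entire
  function \<open>F\<close> with \<open>(a - z) F(z) = x\<close> which vanishes at infinity.  By Liouville's theorem, applied to
  a functional that norms \<open>F(0)\<close>, it follows that \<open>F(0) = 0\<close>, and so \<open>x = 0\<close>.\<close>

theorem intertwiner_zero:
  fixes a b x :: "'a::complex_unital_banach_algebra"
  assumes intertwines: "a * x = x * b"
    and spectra_disjoint: "resolvent_set a \<union> resolvent_set b = UNIV"
  shows "x = 0"
proof -
  define F where "F = (\<lambda>z. if z \<in> resolvent_set a then resolvent a z * x else x * resolvent b z)"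
  have shift: "(a - z *\<^sub>C 1) * x = x * (b - z *\<^sub>C 1)" for z
    using intertwines by (simp add: algebra_simps mult_scaleC_left mult_scaleC_right)
  have agree: "resolvent a z * x = x * resolvent b z"
    if "z \<in> resolvent_set a" "z \<in> resolvent_set b" for z
  proof -
    have "resolvent a z * x = resolvent a z * (x * (b - z *\<^sub>C 1)) * resolvent b z"
      using that by (simp add: resolvent_mult mult.assoc)
    also have "\<dots> = resolvent a z * (a - z *\<^sub>C 1) * x * resolvent b z"
      by (simp only: shift[symmetric] mult.assoc)
    finally show ?thesis
      using that by (simp add: resolvent_mult)
  qed
  have F_inverts: "(a - z *\<^sub>C 1) * F z = x" for z
  proof (cases "z \<in> resolvent_set a")
    case True
    then show ?thesis
      by (simp add: F_def resolvent_mult flip: mult.assoc)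
  next
    case False
    then have "z \<in> resolvent_set b"
      using spectra_disjoint by blast
    then have "(a - z *\<^sub>C 1) * F z = x * ((b - z *\<^sub>C 1) * resolvent b z)"
      using False by (simp add: F_def shift flip: mult.assoc)
    then show ?thesis
      using \<open>z \<in> resolvent_set b\<close> by (simp add: resolvent_mult)
  qed
  have F_zero: "(F \<longlongrightarrow> 0) at_infinity"
  proof (rule Lim_null_comparison)
    define M where "M = max (norm a) (norm b)"
    define K where "K = norm (1::'a) * norm x"
    have "\<forall>\<^sub>F z in at_infinity. M + 1 \<le> cmod z"
      unfolding eventually_at_infinity by blast
    then show "\<forall>\<^sub>F z in at_infinity. norm (F z) \<le> K / (cmod z - M)"
    proof eventually_elim
      case (elim z)
      have res: "norm (resolvent c z) * norm x \<le> K / (cmod z - M)"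
        if "z \<in> resolvent_set c" "norm c \<le> M" for c :: 'a
      proof -
        have "norm (resolvent c z) \<le> norm (1::'a) / (cmod z - norm c)"
          using that elim by (intro resolvent_bound) auto
        also have "\<dots> \<le> norm (1::'a) / (cmod z - M)"
          using that elim by (intro divide_left_mono) auto
        finally have "norm (resolvent c z) * norm x \<le> norm (1::'a) / (cmod z - M) * norm x"
          by (rule mult_right_mono) simp
        then show ?thesis
          by (simp add: K_def)
      qed
      show ?case
      proof (cases "z \<in> resolvent_set a")
        case True
        then show ?thesis
          using res[of a] norm_mult_ineq[of "resolvent a z" x] by (simp add: F_def M_def)
      next
        case False
        then have "z \<in> resolvent_set b"
          using spectra_disjoint by blast
        then show ?thesis
          using False res[of b] norm_mult_ineq[of x "resolvent b z"]
          by (simp add: F_def M_def mult.commute[of "norm x"])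
      qed
    qed
    have "filterlim (\<lambda>z. cmod z - M) at_top at_infinity"
      using filterlim_tendsto_add_at_top[OF tendsto_const filterlim_norm_at_top, of "- M"] by simp
    then show "((\<lambda>z. K / (cmod z - M)) \<longlongrightarrow> 0) at_infinity"
      by (rule real_tendsto_divide_at_top[OF tendsto_const])
  qed
  have "F 0 = 0"
  proof -
    obtain \<phi> :: "'a \<Rightarrow>\<^sub>L complex" where \<phi>: "\<And>z y. \<phi> (z *\<^sub>C y) = z * \<phi> y"
      "\<And>y. cmod (\<phi> y) \<le> norm y" "\<phi> (F 0) = norm (F 0)"
      by (rule complex_norming_functional[of "F 0"]) (rule that; assumption)
    have left: "bounded_linear (\<lambda>y. \<phi> (y * x))" and right: "bounded_linear (\<lambda>y. \<phi> (x * y))"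
      by (intro bounded_linear_compose[OF blinfun.bounded_linear_right]
          bounded_linear_mult_left bounded_linear_mult_right)+
    have "(\<lambda>z. if z \<in> resolvent_set a then \<phi> (resolvent a z * x) else \<phi> (x * resolvent b z))
        holomorphic_on (resolvent_set a \<union> resolvent_set b)"
    proof (intro holomorphic_on_If_Un open_resolvent_set)
      show "(\<lambda>z. \<phi> (resolvent a z * x)) holomorphic_on resolvent_set a"
        by (rule holomorphic_on_resolvent[OF left]) (simp add: mult_scaleC_left \<phi>(1))
      show "(\<lambda>z. \<phi> (x * resolvent b z)) holomorphic_on resolvent_set b"
        by (rule holomorphic_on_resolvent[OF right]) (simp add: mult_scaleC_right \<phi>(1))
    qed (use agree in auto)
    moreover have "(\<lambda>z. \<phi> (F z))
        = (\<lambda>z. if z \<in> resolvent_set a then \<phi> (resolvent a z * x) else \<phi> (x * resolvent b z))"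
      by (rule ext) (simp add: F_def)
    ultimately have "(\<lambda>z. \<phi> (F z)) holomorphic_on UNIV"
      by (simp only: spectra_disjoint)
    moreover have "((\<lambda>z. \<phi> (F z)) \<longlongrightarrow> 0) at_infinity"
      using blinfun.tendsto[OF tendsto_const F_zero, of \<phi>] by (simp add: blinfun.zero_right)
    ultimately have "\<phi> (F 0) = 0"
      by (rule Liouville_weak_0)
    then show ?thesis
      using \<phi>(3) by simp
  qed
  then show ?thesis
    using F_inverts[of 0] by simp
qed

section \<open>Uniqueness of positive square roots\<close>

text \<open>If \<open>\<phi>\<close> norms \<open>x\<close>, then \<open>y \<mapsto> \<phi> (y * x) / norm x\<close> is one of the functionals that define the
  numerical range.  Its value at \<open>c - z\<close> is at least \<open>\<delta>\<close> in modulus, and at most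
  \<open>norm ((c - z) * x) / norm x\<close>.\<close>

lemma norm_diff_scaleC_ge:
  fixes c x :: "'a::complex_unital_banach_algebra"
  assumes "\<And>\<mu>. \<mu> \<in> numerical_range c \<Longrightarrow> \<delta> \<le> cmod (\<mu> - z)"
  shows "\<delta> * norm x \<le> norm ((c - z *\<^sub>C 1) * x)"
proof (cases "x = 0")
  case False
  obtain \<phi> :: "'a \<Rightarrow>\<^sub>L complex" where \<phi>: "\<And>z y. \<phi> (z *\<^sub>C y) = z * \<phi> y"
    "\<And>y. cmod (\<phi> y) \<le> norm y" "\<phi> x = norm x"
    by (rule complex_norming_functional[of x]) (rule that; assumption)
  define \<psi> where "\<psi> = Blinfun (\<lambda>y. \<phi> (y * x) / norm x)"
  have "bounded_linear (\<lambda>y. \<phi> (y * x) / norm x)"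
    by (intro bounded_linear_compose[OF bounded_linear_divide]
        bounded_linear_compose[OF blinfun.bounded_linear_right] bounded_linear_mult_left)
  then have \<psi>: "\<psi> y = \<phi> (y * x) / norm x" for y
    by (simp add: \<psi>_def bounded_linear_Blinfun_apply)
  have "norm \<psi> \<le> 1"
  proof (rule norm_blinfun_bound)
    show "norm (\<psi> y) \<le> 1 * norm y" for y
      using order_trans[OF \<phi>(2)[of "y * x"] norm_mult_ineq] False
      by (simp add: \<psi> norm_divide field_simps)
  qed simp
  moreover have "\<psi> 1 = 1" "\<psi> (w *\<^sub>C y) = w * \<psi> y" for w y
    using False by (simp_all add: \<psi> \<phi> mult_scaleC_left)
  ultimately have "\<delta> \<le> cmod (\<psi> c - z)"
    by (intro assms) (auto simp: numerical_range_def)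
  also have "\<psi> c - z = \<psi> (c - z *\<^sub>C 1)"
    by (simp add: blinfun.diff_right \<open>\<psi> 1 = 1\<close> \<open>\<And>w y. \<psi> (w *\<^sub>C y) = w * \<psi> y\<close>)
  finally have "\<delta> * norm x \<le> cmod (\<phi> ((c - z *\<^sub>C 1) * x))"
    using False by (simp add: \<psi> norm_divide field_simps)
  then show ?thesis
    using \<phi>(2) by (rule order_trans)
qed simp

lemma large_in_resolvent_set:
  fixes a :: "'a::complex_unital_banach_algebra"
  assumes large: "norm (1::'a) * norm a < cmod z"
  shows "z \<in> resolvent_set a"
proof -
  have z: "z \<noteq> 0"
    using order.strict_trans1[OF _ large, of 0] by simp
  define u where "u = (- z) *\<^sub>C (1::'a)"
  have u: "u * (inverse (- z) *\<^sub>C 1) = 1" "(inverse (- z) *\<^sub>C 1) * u = 1"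
    using z by (simp_all add: u_def mult_scaleC_left mult_scaleC_right scaleC_scaleC scaleC_one)
  then have "inverse_of u = inverse (- z) *\<^sub>C 1"
    by (rule inverse_of_eq)
  then have "norm (inverse_of u) * norm (- a) < 1"
    using large z by (simp add: norm_scaleC norm_inverse norm_divide field_simps)
  then have "is_invertible (u - (- a))"
    using u by (intro is_invertible_perturbation) (auto simp: is_invertible_def)
  then show ?thesis
    by (simp add: resolvent_set_def u_def scaleC_minus_left)
qed

text \<open>A ray from \<open>z\<close> away from the origin keeps a distance \<open>\<delta>\<close> from the half line that contains the
  numerical range, and so \<open>norm (1) / \<delta>\<close> bounds every resolvent on it.  Hence invertibility at one
  point of the ray carries over to all points within a fixed distance, and finitely many steps lead
  from far out, where the Neumann series applies, down to \<open>z\<close>.\<close>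

lemma resolvent_set_positive:
  fixes c :: "'a::complex_unital_banach_algebra"
  assumes c: "is_positive c" and z: "z \<notin> \<real>\<^sub>\<ge>\<^sub>0"
  shows "z \<in> resolvent_set c"
proof -
  have "open (- \<real>\<^sub>\<ge>\<^sub>0 :: complex set)"
    by (simp add: closed_nonneg_Reals_complex flip: closed_def)
  then obtain \<delta> where \<delta>: "0 < \<delta>" "ball z \<delta> \<subseteq> - \<real>\<^sub>\<ge>\<^sub>0"
    using z by (meson ComplI open_contains_ball)
  have distance: "\<delta> \<le> cmod (\<mu> - of_real r * z)" if "\<mu> \<in> \<real>\<^sub>\<ge>\<^sub>0" "1 \<le> r" for \<mu> r
  proof -
    have "\<mu> / of_real r \<in> \<real>\<^sub>\<ge>\<^sub>0"
      using that by (intro nonneg_Reals_divide_I) auto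
    then have "\<delta> \<le> cmod (\<mu> / of_real r - z)"
      using \<delta>(2) by (force simp: dist_norm norm_minus_commute)
    also have "\<dots> \<le> r * cmod (\<mu> / of_real r - z)"
      using that mult_right_mono[of 1 r "cmod (\<mu> / of_real r - z)"] by simp
    also have "\<dots> = cmod (of_real r * (\<mu> / of_real r - z))"
      using that by (simp add: norm_mult)
    also have "of_real r * (\<mu> / of_real r - z) = \<mu> - of_real r * z"
      using that by (simp add: field_simps)
    finally show ?thesis .
  qed
  \<comment> \<open>\<open>1 / K\<close> is an admissible step length in the parameter \<open>r\<close>; the summand \<open>1\<close> makes the
    perturbation estimate strict.\<close>
  define K where "K = norm (1::'a) / \<delta> * (cmod z * norm (1::'a)) + 1"
  have K: "0 < K"
    using \<delta> by (simp add: K_def add_nonneg_pos)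
  have step: "of_real (r - 1 / K) * z \<in> resolvent_set c"
    if r: "of_real r * z \<in> resolvent_set c" "1 \<le> r" for r
  proof -
    let ?R = "resolvent c (of_real r * z)"
    have "\<delta> * norm ?R \<le> norm ((c - (of_real r * z) *\<^sub>C 1) * ?R)"
      using c r(2) distance by (intro norm_diff_scaleC_ge) (auto simp: is_positive_def)
    then have "norm ?R * \<delta> \<le> norm (1::'a)"
      by (simp only: resolvent_mult[OF r(1)] mult.commute[of \<delta>])
    then have "norm ?R \<le> norm (1::'a) / \<delta>"
      using \<delta>(1) by (simp add: pos_le_divide_eq)
    then have "norm ?R * norm ((- of_real (1 / K) * z) *\<^sub>C (1::'a))
        \<le> norm (1::'a) / \<delta> * norm ((- of_real (1 / K) * z) *\<^sub>C (1::'a))"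
      by (rule mult_right_mono) simp
    also have "\<dots> = norm (1::'a) / \<delta> * (cmod z * norm (1::'a)) / K"
      using K by (simp add: norm_scaleC norm_mult norm_divide)
    also have "\<dots> = (K - 1) / K"
      by (simp add: K_def)
    also have "\<dots> < 1"
      using K by simp
    finally have "is_invertible (c - (of_real r * z) *\<^sub>C 1 - (- of_real (1 / K) * z) *\<^sub>C 1)"
      using r unfolding resolvent_set_def resolvent_def
      by (intro is_invertible_perturbation[of "c - (of_real r * z) *\<^sub>C 1"]) auto
    then show ?thesis
      by (simp add: resolvent_set_def scaleC_diff_left scaleC_minus_left left_diff_distrib diff_diff_eq2 diff_add_eq)
  qed
  have "z \<noteq> 0"
    using z by auto
  then have "0 < cmod z / K"
    using K by simp
  then obtain N :: nat where "norm (1::'a) * norm c < of_nat N * (cmod z / K)"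
    using reals_Archimedean3 by blast
  also have "\<dots> \<le> cmod (of_real (1 + real N / K) * z)"
  proof -
    have "cmod (of_real (1 + real N / K) * z) = (1 + real N / K) * cmod z"
      using K by (simp only: norm_mult norm_of_real) simp
    then show ?thesis
      using K by (simp add: field_simps)
  qed
  finally have start: "of_real (1 + real N / K) * z \<in> resolvent_set c"
    by (rule large_in_resolvent_set)
  have "of_real (1 + real 0 / K) * z \<in> resolvent_set c"
  proof (rule inc_induct[of 0 N])
    fix n
    assume "of_real (1 + real (Suc n) / K) * z \<in> resolvent_set c"
    then show "of_real (1 + real n / K) * z \<in> resolvent_set c"
      using step[of "1 + real (Suc n) / K"] K by (simp add: add_divide_distrib)
  qed (use start in auto)
  then show ?thesis
    by simp
qed

lemma resolvent_set_minus:
  fixes a :: "'a::complex_unital_banach_algebra"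
  shows "z \<in> resolvent_set (- a) \<longleftrightarrow> - z \<in> resolvent_set a"
proof -
  have "is_invertible (- u)" if "is_invertible u" for u :: 'a
  proof -
    have "- u * - inverse_of u = 1" "- inverse_of u * - u = 1"
      using that by (simp_all add: inverse_of_inverse)
    then show ?thesis
      unfolding is_invertible_def by blast
  qed
  from this this[of "- u" for u] have "is_invertible (- u) \<longleftrightarrow> is_invertible u" for u :: 'a
    by auto
  from this[of "a + z *\<^sub>C 1"] show ?thesis
    by (simp add: resolvent_set_def scaleC_minus_left)
qed

text \<open>From \<open>d * d = u = d' * d'\<close> it follows that \<open>d * (d - d') = (d - d') * (- d')\<close>.  The spectra of \<open>d\<close>
  and of \<open>- d'\<close> lie on opposite half lines, and \<open>0\<close> is excluded from them by the invertibility of \<open>u\<close>.\<close>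

theorem positive_sqrt_unique:
  fixes u :: "'a::complex_unital_banach_algebra"
  assumes u: "is_invertible u" and d: "is_positive_sqrt u d" and d': "is_positive_sqrt u d'"
  shows "d = d'"
proof -
  have "z \<in> resolvent_set d \<or> z \<in> resolvent_set (- d')" for z
  proof (cases "z = 0")
    case True
    then show ?thesis
      using u d is_invertible_factor[of d]
      by (simp add: resolvent_set_def is_positive_sqrt_def scaleC_zero_left)
  next
    case False
    then have "z \<notin> \<real>\<^sub>\<ge>\<^sub>0 \<or> - z \<notin> \<real>\<^sub>\<ge>\<^sub>0"
      by (auto simp: complex_nonneg_Reals_iff complex_eq_iff)
    then show ?thesis
      using d d' resolvent_set_positive[of d z] resolvent_set_positive[of d' "- z"]
      by (auto simp: is_positive_sqrt_def resolvent_set_minus)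
  qed
  moreover have "d * (d - d') = (d - d') * - d'"
    using d d' by (simp add: is_positive_sqrt_def algebra_simps)
  ultimately have "d - d' = 0"
    by (intro intertwiner_zero[of d "d - d'" "- d'"]) auto
  then show ?thesis
    by simp
qed

section \<open>Left multiplication operators\<close>

lemma summable_alg_exp:
  fixes x :: "'a::complex_unital_banach_algebra"
  shows "summable (\<lambda>n. x ^ n /\<^sub>R fact n)"
proof (rule summable_comparison_test')
  show "summable (\<lambda>n. norm (1::'a) * (norm x ^ n /\<^sub>R fact n))"
    by (intro summable_mult sums_summable[OF exp_converges])
  show "norm (x ^ n /\<^sub>R fact n) \<le> norm (1::'a) * (norm x ^ n /\<^sub>R fact n)" for n
    using norm_power_le_norm_one[of x n] by (simp add: field_simps)
qed

lemma alg_exp_zero: "alg_exp (0::'a::complex_unital_banach_algebra) = 1"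
proof -
  have "(0::'a) ^ n /\<^sub>R fact n = (if n = 0 then 1 else 0)" for n
    by (cases n) simp_all
  then show ?thesis
    using sums_single[of 0 "\<lambda>_. 1::'a", THEN sums_unique] by (simp add: alg_exp_def)
qed

lemma alg_exp_idempotent:
  fixes p :: "'a::complex_unital_banach_algebra"
  assumes p: "p * p = p"
  shows "alg_exp (z *\<^sub>C p) = 1 - p + exp z *\<^sub>C p"
proof -
  have power: "(z *\<^sub>C p) ^ Suc n = z ^ Suc n *\<^sub>C p" for n
    by (induction n) (simp_all add: mult_scaleC_left mult_scaleC_right scaleC_scaleC p mult_ac)
  have scale: "(r *\<^sub>R w) *\<^sub>C p = r *\<^sub>R w *\<^sub>C p" for r w
    by (simp add: scaleR_conv_of_real scaleC_of_real flip: scaleC_scaleC)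
  have "(z *\<^sub>C p) ^ n /\<^sub>R fact n = (if n = 0 then 1 - p else 0) + (z ^ n /\<^sub>R fact n) *\<^sub>C p" for n
    by (cases n) (simp_all only: power scale, simp_all add: scaleC_one)
  moreover have "(\<lambda>n. (if n = 0 then 1 - p else 0) + (z ^ n /\<^sub>R fact n) *\<^sub>C p)
      sums (1 - p + exp z *\<^sub>C p)"
    by (intro sums_add sums_single[of 0 "\<lambda>_. 1 - p"]
        bounded_linear.sums[OF bounded_linear_scaleC_left] exp_converges)
  ultimately show ?thesis
    by (simp add: alg_exp_def sums_iff)
qed

lemma left_mult_one: "left_mult 1 = 1"
  by (rule cblinop_eqI) (simp add: app_one)

lemma left_mult_mult: "left_mult (a * b) = left_mult a * left_mult b"
  by (rule cblinop_eqI) (simp add: app_mult mult.assoc)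

lemma left_mult_scaleC: "left_mult (z *\<^sub>C a) = z *\<^sub>C left_mult a"
  by (rule cblinop_eqI) (simp add: app_scaleC_left mult_scaleC_left)

lemma left_mult_power: "left_mult (a ^ n) = left_mult a ^ n"
  by (induction n) (simp_all add: left_mult_one left_mult_mult)

lemma left_mult_eq_iff: "left_mult a = left_mult b \<longleftrightarrow> a = b"
  by (metis app_left_mult mult_1_right)

lemma norm_left_mult_le: "norm (left_mult a) \<le> norm a"
  by (rule norm_cblinop_bound) (simp_all add: norm_mult_ineq)

lemma norm_left_mult:
  assumes "norm (1::'a::complex_unital_banach_algebra) = 1"
  shows "norm (left_mult a) = norm (a::'a)"
  using norm_left_mult_le[of a] norm_app_le[of "left_mult a" 1] assms by simp

lemma bounded_linear_left_mult: "bounded_linear left_mult"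
proof (rule bounded_linear_intro[where K = 1])
  show "left_mult (a + b) = left_mult a + left_mult b" for a b :: 'a
    by (rule cblinop_eqI) (simp add: app_add_left distrib_right)
  show "left_mult (r *\<^sub>R a) = r *\<^sub>R left_mult a" for r and a :: 'a
    by (rule cblinop_eqI) (simp add: app_scaleR_left)
qed (simp add: norm_left_mult_le)

lemma alg_exp_left_mult: "alg_exp (left_mult a) = left_mult (alg_exp a)"
proof -
  interpret L: bounded_linear left_mult by (rule bounded_linear_left_mult)
  have "(\<lambda>n. left_mult (a ^ n /\<^sub>R fact n)) sums left_mult (alg_exp a)"
    unfolding alg_exp_def by (intro L.sums summable_sums summable_alg_exp)
  then show ?thesis
    by (simp add: alg_exp_def[of "left_mult a"] sums_iff L.scaleR left_mult_power)
qed

lemma is_invertible_left_mult: "is_invertible u \<Longrightarrow> is_invertible (left_mult u)"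
  unfolding is_invertible_def by (metis left_mult_mult left_mult_one)

lemma inverse_of_left_mult:
  assumes "is_invertible u"
  shows "inverse_of (left_mult u) = left_mult (inverse_of u)"
  using assms by (intro inverse_of_eq) (simp_all add: inverse_of_inverse left_mult_one flip: left_mult_mult)

text \<open>Composition with \<open>left_mult\<close> turns a functional that defines the numerical range of
  \<open>left_mult c\<close> into one that defines the numerical range of \<open>c\<close>.\<close>

lemma is_positive_left_mult:
  assumes "is_positive c"
  shows "is_positive (left_mult c)"
proof -
  have "\<Phi> (left_mult c) \<in> numerical_range c"
    if \<Phi>: "\<And>z T. \<Phi> (z *\<^sub>C T) = z * \<Phi> T" "norm \<Phi> \<le> 1" "\<Phi> 1 = 1"
    for \<Phi> :: "'a cblinop \<Rightarrow>\<^sub>L complex"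
  proof -
    define \<phi> where "\<phi> = Blinfun (\<lambda>x. \<Phi> (left_mult x))"
    have \<phi>: "\<phi> x = \<Phi> (left_mult x)" for x
      unfolding \<phi>_def
      by (subst bounded_linear_Blinfun_apply)
        (intro bounded_linear_compose[OF blinfun.bounded_linear_right bounded_linear_left_mult] refl)+
    have "norm \<phi> \<le> 1"
    proof (rule norm_blinfun_bound)
      fix x
      have "norm (\<Phi> (left_mult x)) \<le> 1 * norm x"
        using norm_blinfun[of \<Phi> "left_mult x"]
          mult_mono[OF \<Phi>(2) norm_left_mult_le[of x]] by simp
      then show "norm (\<phi> x) \<le> 1 * norm x"
        by (simp only: \<phi>)
    qed simp
    moreover have "\<phi> (z *\<^sub>C x) = z * \<phi> x" "\<phi> 1 = 1" for z x
      by (simp_all add: \<phi> \<Phi> left_mult_scaleC left_mult_one)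
    ultimately show ?thesis
      unfolding numerical_range_def by (intro CollectI exI[of _ \<phi>]) (simp add: \<phi>)
  qed
  then have "numerical_range (left_mult c) \<subseteq> numerical_range c"
    by (auto simp: numerical_range_def[of "left_mult c"])
  with assms show ?thesis
    by (auto simp: is_positive_def)
qed

lemma weighted_hermitian_sqrt:
  assumes h: "h \<in> weighted_hermitian u" and u: "is_invertible u"
  shows "is_positive_sqrt u (positive_sqrt u)"
    and "is_invertible (positive_sqrt u)"
    and "norm (positive_sqrt u * alg_exp ((\<i> * complex_of_real t) *\<^sub>C h)
      * inverse_of (positive_sqrt u)) = 1"
proof -
  have "\<exists>!d. is_positive_sqrt u d"
    using h by (simp add: weighted_hermitian_def)
  then show sqrt: "is_positive_sqrt u (positive_sqrt u)"
    unfolding positive_sqrt_def by (rule theI')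
  then show "is_invertible (positive_sqrt u)"
    using u by (auto simp: is_positive_sqrt_def intro: is_invertible_factor)
  show "norm (positive_sqrt u * alg_exp ((\<i> * complex_of_real t) *\<^sub>C h)
      * inverse_of (positive_sqrt u)) = 1"
    using h by (simp add: weighted_hermitian_def hermitian_wrt_def weighted_norm_def)
qed

text \<open>Left multiplication preserves exponentials, and it is isometric since a hermitian element forces
  \<open>norm 1 = 1\<close>.  The substantial point is that the weighted norm for \<open>left_mult u\<close> is formed with
  the operator \<open>left_mult d\<close>, where \<open>d\<close> is the positive square root of \<open>u\<close>: this needs uniqueness of
  the positive square root among all operators, not only among left multiplications.\<close>

lemma left_mult_weighted_hermitian:
  assumes h: "h \<in> weighted_hermitian u" and u: "is_invertible u"
  shows "left_mult h \<in> weighted_hermitian (left_mult u)"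
proof -
  define d where "d = positive_sqrt u"
  note d = weighted_hermitian_sqrt[OF h u, folded d_def]
  \<comment> \<open>This is the hermitian condition at \<open>t = 0\<close>.\<close>
  have norm_one: "norm (1::'a) = 1"
    using d(3)[of 0] d(2) by (simp add: scaleC_zero_left alg_exp_zero inverse_of_inverse)
  have sqrt: "is_positive_sqrt (left_mult u) (left_mult d)"
    using d(1) is_positive_left_mult[of d] by (auto simp: is_positive_sqrt_def simp flip: left_mult_mult)
  have uniq: "d' = left_mult d" if "is_positive_sqrt (left_mult u) d'" for d'
    using is_invertible_left_mult[OF u] that sqrt by (rule positive_sqrt_unique)
  then have "positive_sqrt (left_mult u) = left_mult d"
    unfolding positive_sqrt_def using sqrt by (intro the_equality)
  then have "weighted_norm (left_mult u) (alg_exp ((\<i> * complex_of_real t) *\<^sub>C left_mult h)) = 1" for t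
    using d(3)[of t] norm_left_mult[OF norm_one]
    by (simp add: weighted_norm_def inverse_of_left_mult d(2) alg_exp_left_mult
        flip: left_mult_scaleC left_mult_mult)
  then show ?thesis
    using sqrt uniq by (auto simp: weighted_hermitian_def hermitian_wrt_def)
qed

section \<open>Hermitian idempotents\<close>

text \<open>The powers \<open>(1 + n) ^ k = 1 + k * n\<close> have norm at most \<open>1\<close>, which for large \<open>k\<close> is possible only if
  \<open>n = 0\<close>.\<close>

lemma nilpotent_zero:
  fixes n :: "'a::complex_unital_banach_algebra"
  assumes n: "n * n = 0" and contraction: "norm (1 + n) \<le> 1"
  shows "n = 0"
proof (rule ccontr)
  assume "n \<noteq> 0"
  have power: "(1 + n) ^ k = 1 + real k *\<^sub>R n" for k
    by (induction k) (simp_all add: algebra_simps n)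
  have bound: "norm ((1 + n) ^ Suc k) \<le> 1" for k
  proof (induction k)
    case (Suc k)
    have "norm ((1 + n) ^ Suc (Suc k)) \<le> norm (1 + n) * norm ((1 + n) ^ Suc k)"
      unfolding power_Suc[of _ "Suc k"] by (rule norm_mult_ineq)
    also have "\<dots> \<le> 1 * 1"
      using contraction Suc by (intro mult_mono) auto
    finally show ?case
      by simp
  qed (use contraction in simp)
  obtain k :: nat where "1 + norm (1::'a) < of_nat k * norm n"
    using reals_Archimedean3 \<open>n \<noteq> 0\<close> by (metis zero_less_norm_iff)
  moreover have "real (Suc k) * norm n \<le> 1 + norm (1::'a)"
  proof -
    have "real (Suc k) *\<^sub>R n = (1 + n) ^ Suc k - 1"
      unfolding power by simp
    then have "real (Suc k) * norm n = norm ((1 + n) ^ Suc k - 1)"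
      using norm_scaleR[of "real (Suc k)" n] by simp
    then show ?thesis
      using norm_triangle_ineq4[of "(1 + n) ^ Suc k" 1] bound[of k] by linarith
  qed
  moreover have "real k * norm n \<le> real (Suc k) * norm n"
    by (intro mult_right_mono) auto
  ultimately show False
    by linarith
qed

text \<open>The hypothesis \<open>same\<close> says that left multiplication by \<open>p\<close> and by \<open>q\<close> has the same range, or
  the same null space.  For a hermitian idempotent \<open>p\<close> the reflection \<open>1 - 2 p = exp (\<i> \<pi> p)\<close> has weighted
  norm \<open>1\<close>, and the product of the reflections of \<open>p\<close> and \<open>q\<close> is \<open>1 + m\<close> with
  \<open>m = \<plusminus> 2 (q - p)\<close>, whose square vanishes.  Conjugation by the square root of the weight turns the
  weighted norm into the original one.\<close>

lemma hermitian_idempotents_eq: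
  fixes p q u :: "'a::complex_unital_banach_algebra"
  assumes u: "is_invertible u" and p: "p \<in> weighted_hermitian u" "p * p = p"
    and q: "q \<in> weighted_hermitian u" "q * q = q"
    and same: "p * q = q \<and> q * p = p \<or> p * q = p \<and> q * p = q"
  shows "p = q"
proof -
  define d where "d = positive_sqrt u"
  note d = weighted_hermitian_sqrt[OF p(1) u, folded d_def]
    and d' = weighted_hermitian_sqrt[OF q(1) u, folded d_def]
  define c where "c = inverse_of d"
  have c: "d * c = 1" "c * d = 1"
    using d(2) by (simp_all add: c_def inverse_of_inverse)
  have reflection: "alg_exp ((\<i> * complex_of_real pi) *\<^sub>C r) = 1 - r - r" if "r * r = r" for r :: 'a
    using that by (simp add: alg_exp_idempotent mult.commute[of \<i>] scaleC_minus_one)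
  define m where "m = (1 - p - p) * (1 - q - q) - 1"
  define n where "n = q - p"
  have "m = n + n \<or> m = - (n + n)"
    using same by (auto simp: m_def n_def algebra_simps)
  moreover have nn: "n * n = 0"
    using same p q by (auto simp: n_def algebra_simps)
  ultimately have mm: "m * m = 0"
    by (auto simp: distrib_left distrib_right left_diff_distrib right_diff_distrib)
  have m0: "p = q" if "m = 0"
  proof -
    have "n + n = 0"
      using \<open>m = n + n \<or> m = - (n + n)\<close> that by (metis neg_0_equal_iff_equal)
    then have "2 *\<^sub>R n = 0"
      by (simp only: scaleR_2)
    then show ?thesis
      by (simp add: n_def)
  qed
  have "d * m * c * (d * m * c) = d * m * (c * d) * m * c"
    by (simp only: mult.assoc)
  also have "\<dots> = d * (m * m) * c"
    by (simp add: c mult.assoc)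
  finally have square: "d * m * c * (d * m * c) = 0"
    by (simp add: mm)
  have product: "1 + d * m * c = d * (1 - p - p) * c * (d * (1 - q - q) * c)"
  proof -
    have "d * (1 - p - p) * c * (d * (1 - q - q) * c) = d * (1 - p - p) * (c * d) * (1 - q - q) * c"
      by (simp only: mult.assoc)
    also have "\<dots> = d * (1 + m) * c"
      by (simp add: c m_def mult.assoc)
    finally show ?thesis
      by (simp add: distrib_left distrib_right c)
  qed
  have "norm (d * (1 - p - p) * c) = 1" "norm (d * (1 - q - q) * c) = 1"
    using d(3)[of pi] d'(3)[of pi] by (simp_all only: reflection p q c_def)
  then have "norm (d * (1 - p - p) * c * (d * (1 - q - q) * c)) \<le> 1"
    using norm_mult_ineq[of "d * (1 - p - p) * c" "d * (1 - q - q) * c"] by simp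
  then have "d * m * c = 0"
    by (intro nilpotent_zero[OF square]) (simp only: product)
  then have "c * (d * m * c) * d = 0"
    by simp
  moreover have "c * (d * m * c) * d = (c * d) * m * (c * d)"
    by (simp only: mult.assoc)
  ultimately show "p = q"
    by (intro m0) (simp add: c)
qed

section \<open>Idempotents and commuting generalized inverses\<close>

lemma app_diff_right: "app T (x - y) = app T x - app T y"
  using app_add_right[of T "x - y" y] by simp

lemma app_diff_left: "app (S - T) x = app S x - app T x"
  using app_add_left[of "S - T" T x] by simp

lemma app_zero_right: "app T 0 = 0"
  using app_diff_right[of T 0 0] by simp

lemma app_idempotent:
  assumes "P * P = P"
  shows "app P (app P x) = app P x"
  using app_mult[of P P x] assms by simp

lemma idempotent_mult_of_range:
  assumes "P * P = P" "op_range Q \<subseteq> op_range P"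
  shows "P * Q = Q"
proof (rule cblinop_eqI)
  fix x
  obtain y where "app Q x = app P y"
    using assms(2) by blast
  then show "app (P * Q) x = app Q x"
    using app_idempotent[OF assms(1)] by (simp add: app_mult)
qed

lemma mult_idempotent_of_null_space:
  assumes "P * P = P" "null_space P \<subseteq> null_space Q"
  shows "Q * P = Q"
proof (rule cblinop_eqI)
  fix x
  have "x - app P x \<in> null_space P"
    using app_idempotent[OF assms(1)] by (simp add: null_space_def app_diff_right)
  then have "x - app P x \<in> null_space Q"
    using assms(2) by blast
  then show "app (Q * P) x = app Q x"
    by (simp add: null_space_def app_mult app_diff_right)
qed

lemma idempotent_determined:
  assumes "P * P = P" "Q * Q = Q" "op_range P = op_range Q" "null_space P = null_space Q"
  shows "P = Q"
  using idempotent_mult_of_range[of P Q] mult_idempotent_of_null_space[of Q P] assms by simp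

lemma is_invertible_of_bij:
  fixes W :: "'x::complex_banach cblinop"
  assumes "bij (app W)"
  shows "is_invertible W"
proof -
  have W_inv: "app W (inv (app W) x) = x" for x
    using assms by (simp add: bij_is_surj surj_f_inv_f)
  have inv_W: "inv (app W) (app W x) = x" for x
    using assms by (simp add: bij_is_inj)
  have "bounded_linear (app W)"
    unfolding app.rep_eq by (rule blinfun.bounded_linear_right)
  then have bl: "bounded_linear (inv (app W))"
    using assms by (rule bounded_inverse_theorem)
  have "inv (app W) (z *\<^sub>C x) = z *\<^sub>C inv (app W) x" for z x
    using inv_W[of "z *\<^sub>C inv (app W) x"] by (simp add: app_scaleC W_inv)
  then have "blinfun_of (Cblinop (Blinfun (inv (app W)))) = Blinfun (inv (app W))"
    by (intro Cblinop_inverse) (simp add: bounded_linear_Blinfun_apply[OF bl])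
  then have V: "app (Cblinop (Blinfun (inv (app W)))) x = inv (app W) x" for x
    by (simp add: app.rep_eq[of "Cblinop _"] bounded_linear_Blinfun_apply[OF bl])
  show ?thesis
    unfolding is_invertible_def
  proof (intro exI conjI)
    show "W * Cblinop (Blinfun (inv (app W))) = 1" "Cblinop (Blinfun (inv (app W))) * W = 1"
      by (rule cblinop_eqI; simp add: app_mult app_one V W_inv inv_W)+
  qed
qed

text \<open>If \<open>P\<close> is an idempotent with the range and the null space of \<open>T\<close>, then \<open>T\<close> maps the range of \<open>P\<close>
  bijectively onto itself and vanishes on its complement.  So \<open>W = T + 1 - P\<close> is bijective, hence
  invertible by the bounded inverse theorem, and commutes with \<open>P\<close>; the generalized inverse is
  \<open>P\<close> composed with the inverse of \<open>W\<close>.\<close>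

lemma commuting_generalized_inverse_iff:
  fixes T P :: "'x::complex_banach cblinop"
  shows "(\<exists>S. normalized_generalized_inverse T S \<and> T * S = P \<and> S * T = P) \<longleftrightarrow>
    P * P = P \<and> op_range P = op_range T \<and> null_space P = null_space T"
proof safe
  fix S
  assume "normalized_generalized_inverse T S" and ST: "S * T = T * S"
  then have TST: "T * S * T = T" and STS: "S * T * S = S"
    by (auto simp: normalized_generalized_inverse_def)
  show "T * S * (T * S) = T * S"
    using TST by (simp flip: mult.assoc)
  have "app T x = app (T * S) (app T x)" for x
    by (simp add: TST flip: app_mult)
  then show "app T x \<in> op_range (T * S)" for x
    by blast
  show "app (T * S) x \<in> op_range T" for x
    by (simp add: app_mult)
  show "x \<in> null_space (T * S)" if "x \<in> null_space T" for x
    using that by (simp add: null_space_def app_mult app_zero_right flip: ST)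
  show "x \<in> null_space T" if "x \<in> null_space (T * S)" for x
  proof -
    have "app T x = app T (app (T * S) x)"
    proof -
      have "T * (T * S) = T * (S * T)"
        by (simp only: ST)
      also have "\<dots> = T"
        using TST by (simp only: mult.assoc)
      finally have "T * (T * S) = T" .
      then show ?thesis
        by (simp flip: app_mult)
    qed
    then show ?thesis
      using that by (simp add: null_space_def app_zero_right)
  qed
next
  assume P: "P * P = P" and range: "op_range P = op_range T" and null: "null_space P = null_space T"
  have PT: "P * T = T"
    using P range by (simp add: idempotent_mult_of_range)
  have TP: "T * P = T"
    using P null by (simp add: mult_idempotent_of_null_space)
  define W where "W = T + 1 - P"
  have WP: "W * P = T" and PW: "P * W = T"
    by (simp_all add: W_def algebra_simps P PT TP)
  have app_W: "app W x = app T x + x - app P x" for x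
    by (simp add: W_def app_add_left app_diff_left app_one)
  have "is_invertible W"
  proof (rule is_invertible_of_bij, rule bijI)
    show "inj (app W)"
    proof (rule injI)
      fix x y
      assume "app W x = app W y"
      then have W0: "app W (x - y) = 0"
        by (simp add: app_diff_right)
      then have "app (P * W) (x - y) = 0"
        by (simp add: app_mult app_zero_right)
      then have "x - y \<in> null_space T"
        by (simp add: PW null_space_def)
      then have "app T (x - y) = 0 \<and> app P (x - y) = 0"
        using null by (auto simp: null_space_def)
      then show "x = y"
        using W0 by (simp add: app_W)
    qed
    show "surj (app W)"
      unfolding surj_def
    proof
      fix y
      obtain u where u: "app P y = app T u"
        using range by blast
      have TP': "app T (app P x) = app T x" for x
        by (simp add: TP flip: app_mult)
      have "y = app W (app P u + (y - app P y))"
        by (simp add: app_W app_add_right app_diff_right app_idempotent[OF P] TP' u[symmetric])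
      then show "\<exists>x. y = app W x" ..
    qed
  qed
  then obtain V where V: "W * V = 1" "V * W = 1"
    by (auto simp: is_invertible_def)
  have PV: "P * V = V * P"
  proof -
    have "P * V = V * (W * P) * V"
      by (simp add: V flip: mult.assoc)
    also have "\<dots> = V * (P * W) * V"
      by (simp add: WP PW)
    also have "\<dots> = V * P * (W * V)"
      by (simp only: mult.assoc)
    finally show ?thesis
      by (simp add: V)
  qed
  have "T * (V * P) = P"
  proof -
    have "T * (V * P) = P * (W * V) * P"
      by (simp only: mult.assoc flip: PW)
    then show ?thesis
      by (simp add: V P)
  qed
  moreover have "V * P * T = P"
    by (simp add: mult.assoc PT, simp add: V flip: WP mult.assoc)
  moreover have "P * (V * P) = V * P"
  proof -
    have "P * (V * P) = V * (P * P)"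
      by (simp only: PV flip: mult.assoc)
    then show ?thesis
      by (simp add: P)
  qed
  ultimately show "\<exists>S. normalized_generalized_inverse T S \<and> T * S = P \<and> S * T = P"
    by (intro exI[of _ "V * P"]) (simp add: normalized_generalized_inverse_def PT P mult.assoc)
qed


section \<open>Weighted EP elements\<close>

lemma weighted_EP_iff_idempotent:
  fixes E F T :: "'x::complex_banach cblinop"
  shows "weighted_EP E F T \<longleftrightarrow>
    (\<exists>P. P * P = P \<and> P \<in> weighted_hermitian E \<inter> weighted_hermitian F \<and>
      op_range P = op_range T \<and> null_space P = null_space T)"
proof -
  have "weighted_EP E F T \<longleftrightarrow> (\<exists>P. P \<in> weighted_hermitian E \<inter> weighted_hermitian F \<and>
      (\<exists>S. normalized_generalized_inverse T S \<and> T * S = P \<and> S * T = P))"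
    unfolding weighted_EP_def is_weighted_MP_inverse_def by auto
  then show ?thesis
    unfolding commuting_generalized_inverse_iff by blast
qed

lemma weighted_MP_inverse_left_mult:
  assumes "is_weighted_MP_inverse e f a b" "is_invertible e" "is_invertible f"
  shows "is_weighted_MP_inverse (left_mult e) (left_mult f) (left_mult a) (left_mult b)"
  using assms left_mult_weighted_hermitian[of "a * b" e] left_mult_weighted_hermitian[of "b * a" f]
  unfolding is_weighted_MP_inverse_def normalized_generalized_inverse_def
  by (simp flip: left_mult_mult)

text \<open>The operator \<open>A * B\<close> is an idempotent with the range of \<open>A\<close> and is hermitian for the weight \<open>E\<close>, as
  \<open>P\<close> is; and \<open>B * A\<close> is an idempotent with the null space of \<open>A\<close> and is hermitian for the weight
  \<open>F\<close>, as \<open>P\<close> is.  Each of them must therefore be \<open>P\<close>.\<close>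

lemma weighted_MP_inverse_commutes:
  fixes A B P E F :: "'x::complex_banach cblinop"
  assumes inv: "is_invertible E" "is_invertible F" and B: "is_weighted_MP_inverse E F A B"
    and P: "P * P = P" "P \<in> weighted_hermitian E \<inter> weighted_hermitian F"
      "op_range P = op_range A" "null_space P = null_space A"
  shows "A * B = B * A"
proof -
  have ABA: "A * B * A = A" and BAB: "B * A * B = B"
    and herm: "A * B \<in> weighted_hermitian E" "B * A \<in> weighted_hermitian F"
    using B by (auto simp: is_weighted_MP_inverse_def normalized_generalized_inverse_def)
  have idem: "A * B * (A * B) = A * B" "B * A * (B * A) = B * A"
    using ABA BAB by (simp_all flip: mult.assoc)
  have PA: "P * A = A"
    using P by (simp add: idempotent_mult_of_range)
  have AP: "A * P = A"
    using P by (simp add: mult_idempotent_of_null_space)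
  have ABP: "A * B * P = P"
  proof (rule idempotent_mult_of_range[OF idem(1)])
    have "app A x = app (A * B) (app A x)" for x
      by (simp add: ABA flip: app_mult)
    then show "op_range P \<subseteq> op_range (A * B)"
      unfolding P(3) by blast
  qed
  have PBA: "P * (B * A) = P"
  proof (rule mult_idempotent_of_null_space[OF idem(2)])
    show "null_space (B * A) \<subseteq> null_space P"
      unfolding P(4)
    proof
      fix x
      assume "x \<in> null_space (B * A)"
      moreover have "app A x = app A (app (B * A) x)"
        using ABA by (simp add: mult.assoc flip: app_mult)
      ultimately show "x \<in> null_space A"
        by (simp add: null_space_def app_zero_right)
    qed
  qed
  have "P * (A * B) = A * B" "B * A * P = B * A"
    by (simp_all add: PA AP mult.assoc) (simp add: PA flip: mult.assoc)
  then have "P = A * B"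
    using P(2) \<open>P * (A * B) = A * B\<close>
    by (intro hermitian_idempotents_eq[OF inv(1) _ P(1) herm(1) idem(1)] disjI1) (simp_all add: ABP)
  moreover have "P = B * A"
    using P(2) \<open>B * A * P = B * A\<close>
    by (intro hermitian_idempotents_eq[OF inv(2) _ P(1) herm(2) idem(2)] disjI2) (simp_all add: PBA)
  ultimately show ?thesis
    by simp
qed



theorem theorem3p4:
  fixes E F T :: "'x::complex_banach cblinop"
    and e f a :: "'a::complex_unital_banach_algebra"
  shows
    "(is_invertible E \<and> is_positive E \<and> is_invertible F \<and> is_positive F \<longrightarrow>
       (weighted_EP E F T \<longleftrightarrow>
         (\<exists>P. P * P = P \<and> P \<in> weighted_hermitian E \<inter> weighted_hermitian F \<and>
              op_range P = op_range T \<and> null_space P = null_space T)) \<and>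
       (\<exists>\<^sub>\<le>\<^sub>1P. P * P = P \<and> P \<in> weighted_hermitian E \<inter> weighted_hermitian F \<and>
              op_range P = op_range T \<and> null_space P = null_space T)) \<and>
     (is_invertible e \<and> is_positive e \<and> is_invertible f \<and> is_positive f \<and>
      weighted_MP_invertible e f a \<longrightarrow>
       (weighted_EP e f a \<longleftrightarrow>
         (\<exists>P. P * P = P \<and>
              P \<in> weighted_hermitian (left_mult e) \<inter> weighted_hermitian (left_mult f) \<and>
              op_range P = {a * x | x. True} \<and> null_space P = {x. a * x = 0})) \<and>
       (weighted_EP e f a \<longleftrightarrow> weighted_EP (left_mult e) (left_mult f) (left_mult a)) \<and>
       (\<exists>\<^sub>\<le>\<^sub>1P. P * P = P \<and>
              P \<in> weighted_hermitian (left_mult e) \<inter> weighted_hermitian (left_mult f) \<and>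
              op_range P = {a * x | x. True} \<and> null_space P = {x. a * x = 0}))"
proof (intro conjI impI)
  show "weighted_EP E F T \<longleftrightarrow>
      (\<exists>P. P * P = P \<and> P \<in> weighted_hermitian E \<inter> weighted_hermitian F \<and>
        op_range P = op_range T \<and> null_space P = null_space T)"
    by (rule weighted_EP_iff_idempotent)
  show "\<exists>\<^sub>\<le>\<^sub>1P. P * P = P \<and> P \<in> weighted_hermitian E \<inter> weighted_hermitian F \<and>
      op_range P = op_range T \<and> null_space P = null_space T"
    unfolding Uniq_def by (metis idempotent_determined)
next
  have range: "{a * x | x. True} = op_range (left_mult a)"
    and null: "{x. a * x = 0} = null_space (left_mult a)"
    by (auto simp: null_space_def)
  show "\<exists>\<^sub>\<le>\<^sub>1P. P * P = P \<and>
      P \<in> weighted_hermitian (left_mult e) \<inter> weighted_hermitian (left_mult f) \<and>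
      op_range P = {a * x | x. True} \<and> null_space P = {x. a * x = 0}"
    unfolding Uniq_def by (metis idempotent_determined)
  assume "is_invertible e \<and> is_positive e \<and> is_invertible f \<and> is_positive f \<and>
    weighted_MP_invertible e f a"
  then obtain b where e: "is_invertible e" and f: "is_invertible f"
    and b: "is_weighted_MP_inverse e f a b"
    by (auto simp: weighted_MP_invertible_def)
  have EP_iff: "weighted_EP (left_mult e) (left_mult f) (left_mult a) \<longleftrightarrow> (\<exists>P. P * P = P \<and>
      P \<in> weighted_hermitian (left_mult e) \<inter> weighted_hermitian (left_mult f) \<and>
      op_range P = {a * x | x. True} \<and> null_space P = {x. a * x = 0})"
    unfolding range null by (rule weighted_EP_iff_idempotent)
  have "weighted_EP (left_mult e) (left_mult f) (left_mult a)" if EP: "weighted_EP e f a"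
  proof -
    obtain c where c: "is_weighted_MP_inverse e f a c" "a * c = c * a"
      using EP by (auto simp: weighted_EP_def)
    then have "is_weighted_MP_inverse (left_mult e) (left_mult f) (left_mult a) (left_mult c)"
      using e f by (intro weighted_MP_inverse_left_mult)
    with c(2) show ?thesis
      unfolding weighted_EP_def by (metis left_mult_mult)
  qed
  moreover have "weighted_EP e f a" if EP: "weighted_EP (left_mult e) (left_mult f) (left_mult a)"
  proof -
    obtain P where P: "P * P = P"
      "P \<in> weighted_hermitian (left_mult e) \<inter> weighted_hermitian (left_mult f)"
      "op_range P = op_range (left_mult a)" "null_space P = null_space (left_mult a)"
      using EP unfolding weighted_EP_iff_idempotent by blast
    have "left_mult a * left_mult b = left_mult b * left_mult a"
      using is_invertible_left_mult[OF e] is_invertible_left_mult[OF f]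
        weighted_MP_inverse_left_mult[OF b e f] P by (rule weighted_MP_inverse_commutes)
    then have "a * b = b * a"
      by (simp add: left_mult_eq_iff flip: left_mult_mult)
    with b show ?thesis
      by (auto simp: weighted_EP_def)
  qed
  ultimately show EP_left_mult:
    "weighted_EP e f a \<longleftrightarrow> weighted_EP (left_mult e) (left_mult f) (left_mult a)"
    by blast
  show "weighted_EP e f a \<longleftrightarrow> (\<exists>P. P * P = P \<and>
      P \<in> weighted_hermitian (left_mult e) \<inter> weighted_hermitian (left_mult f) \<and>
      op_range P = {a * x | x. True} \<and> null_space P = {x. a * x = 0})"
    unfolding EP_left_mult by (rule EP_iff)
qed

end
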